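(* Let $\kappa$ be a singular strong limit cardinal of cofinality $\lambda>\omega$. Suppose that there is a stationary set $S\subseteq\kappa$ such that $\square^*_\delta$ holds for every $\delta\in S$ and such that the product $\prod_{\delta\in S}\delta^+$ carries a good scale. Then $\square^*_\kappa$ holds.
   Context: For a cardinal $\mu$, a $\square^*_\mu$-sequence is a sequence $\langle \mathcal C_\alpha : \alpha\in\lim(\mu^+)\rangle$ (indexed by limit ordinals $\alpha<\mu^+$) such that for every limit $\alpha<\mu^+$: (1) each $C\in\mathcal C_\alpha$ is a club subset of $\alpha$ with order type $\le\mu$; (2) for every $C\in\mathcal C_\alpha$ and every limit point $\beta$ of $C$ below $\alpha$, $C\cap\beta\in\mathcal C_\beta$; (3) $1\le|\mathcal C_\alpha|\le\mu$. $\square^*_\mu$ means such a sequence exists. For a set $I$ of ordinals and functions $f,g$ with domain $I$, write $f<^* g$ if there is $j$ such that $f(i)<g(i)$ for all $i\in I$ with $i\ge j$ (similarly $\le^*$, $=^*$). The product $\prod_{\delta\in S}\delta^+$ is the set of functions $g$ with domain $S$ and $g(\delta)<\delta^+$ for all $\delta\in S$. A scale on this product is a sequence $\langle f_\alpha:\alpha<\kappa^+\rangle$ of elements of the product such that $f_\beta<^* f_\alpha$ whenever $\beta<\alpha<\kappa^+$, and such that every $g$ in the product satisfies $g<^* f_\alpha$ for some $\alpha<\kappa^+$. An ordinal $\alpha<\kappa^+$ is a good point of $\vec f$ if there exist an unbounded $A\subseteq\alpha$ of order type $\mathrm{cf}(\alpha)$ and an index $j$ such that for all $i\in S$ with $i\ge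 j$, $\langle f_\beta(i):\beta\in A\rangle$ is strictly increasing. The scale is good if there is a club $D\subseteq\kappa^+$ such that every $\alpha\in D$ with $\mathrm{cf}(\alpha)>\mathrm{cf}(\kappa)$ is a good point. *)

theory Defs
  imports Main "HOL-Library.FuncSet" "HOL-Library.Equipollence"
begin

text \<open>
  Ordinals are the elements of an arbitrary well-ordered type, the ordinal \<open>\<alpha>\<close> being identified
  with its initial segment \<open>{..<\<alpha>}\<close>. The type plays the role of a sufficiently long initial segment
  of the ordinals: the operations below that denote a particular ordinal (\<open>omega\<close>, \<open>card_succ\<close>,
  \<open>order_type\<close>, \<open>cof\<close>) are meaningful only if that ordinal is present in the type. For \<open>cof \<alpha>\<close>, and
  for \<open>order_type A\<close> with \<open>A\<close> bounded, this is automatic.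
\<close>

definition limit_ordinal :: "'a::wellorder \<Rightarrow> bool" where
  "limit_ordinal \<alpha> \<longleftrightarrow> {..<\<alpha>} \<noteq> {} \<and> (\<forall>\<beta><\<alpha>. \<exists>\<gamma><\<alpha>. \<beta> < \<gamma>)"

definition omega :: "'a::wellorder" where
  "omega = (LEAST \<alpha>. infinite {..<\<alpha>})"

definition is_cardinal :: "'a::wellorder \<Rightarrow> bool" where
  "is_cardinal \<mu> \<longleftrightarrow> (\<forall>\<beta><\<mu>. {..<\<beta>} \<prec> {..<\<mu>})"

definition card_succ :: "'a::wellorder \<Rightarrow> 'a" where
  "card_succ \<mu> = (LEAST \<alpha>. {..<\<mu>} \<prec> {..<\<alpha>})"

definition order_type :: "'a::wellorder set \<Rightarrow> 'a" where
  "order_type A = (THE \<alpha>. \<exists>h. bij_betw h {..<\<alpha>} A \<and> strict_mono_on {..<\<alpha>} h)"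

definition unbounded_in :: "'a::wellorder \<Rightarrow> 'a set \<Rightarrow> bool" where
  "unbounded_in \<alpha> A \<longleftrightarrow> A \<subseteq> {..<\<alpha>} \<and> (\<forall>\<beta><\<alpha>. \<exists>\<gamma>\<in>A. \<beta> \<le> \<gamma>)"

definition cof :: "'a::wellorder \<Rightarrow> 'a" where
  "cof \<alpha> = (LEAST \<theta>. \<exists>A. unbounded_in \<alpha> A \<and> order_type A = \<theta>)"

definition limit_point :: "'a::wellorder set \<Rightarrow> 'a \<Rightarrow> bool" where
  "limit_point C \<beta> \<longleftrightarrow> {..<\<beta>} \<noteq> {} \<and> (\<forall>\<gamma><\<beta>. \<exists>\<xi>\<in>C. \<gamma> < \<xi> \<and> \<xi> < \<beta>)"

definition club :: "'a::wellorder \<Rightarrow> 'a set \<Rightarrow> bool" where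
  "club \<alpha> C \<longleftrightarrow> unbounded_in \<alpha> C \<and> (\<forall>\<beta><\<alpha>. limit_point C \<beta> \<longrightarrow> \<beta> \<in> C)"

definition stationary :: "'a::wellorder \<Rightarrow> 'a set \<Rightarrow> bool" where
  "stationary \<alpha> S \<longleftrightarrow> S \<subseteq> {..<\<alpha>} \<and> (\<forall>C. club \<alpha> C \<longrightarrow> S \<inter> C \<noteq> {})"

definition singular_cardinal :: "'a::wellorder \<Rightarrow> bool" where
  "singular_cardinal \<kappa> \<longleftrightarrow> is_cardinal \<kappa> \<and> infinite {..<\<kappa>} \<and> cof \<kappa> < \<kappa>"

definition strong_limit_cardinal :: "'a::wellorder \<Rightarrow> bool" where
  "strong_limit_cardinal \<kappa> \<longleftrightarrow>
     is_cardinal \<kappa> \<and> infinite {..<\<kappa>} \<and> (\<forall>\<mu><\<kappa>. is_cardinal \<mu> \<longrightarrow> Pow {..<\<mu>} \<prec> {..<\<kappa>})"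

definition weak_square_seq :: "'a::wellorder \<Rightarrow> ('a \<Rightarrow> 'a set set) \<Rightarrow> bool" where
  "weak_square_seq \<mu> \<C> \<longleftrightarrow>
     (\<forall>\<alpha><card_succ \<mu>. limit_ordinal \<alpha> \<longrightarrow>
        (\<forall>C\<in>\<C> \<alpha>. club \<alpha> C \<and> order_type C \<le> \<mu>) \<and>
        (\<forall>C\<in>\<C> \<alpha>. \<forall>\<beta><\<alpha>. limit_point C \<beta> \<longrightarrow> C \<inter> {..<\<beta>} \<in> \<C> \<beta>) \<and>
        \<C> \<alpha> \<noteq> {} \<and> \<C> \<alpha> \<lesssim> {..<\<mu>})"

definition weak_square :: "'a::wellorder \<Rightarrow> bool" where
  "weak_square \<mu> \<longleftrightarrow> (\<exists>\<C>. weak_square_seq \<mu> \<C>)"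

text \<open>
  The threshold \<open>j\<close> ranges over the index set: if it could be any ordinal, every two functions on a
  bounded \<open>I\<close> would be related.
\<close>

definition less_star :: "'a::wellorder set \<Rightarrow> ('a \<Rightarrow> 'a) \<Rightarrow> ('a \<Rightarrow> 'a) \<Rightarrow> bool" where
  "less_star I f g \<longleftrightarrow> (\<exists>j\<in>I. \<forall>i\<in>I. j \<le> i \<longrightarrow> f i < g i)"

definition succ_product :: "'a::wellorder set \<Rightarrow> ('a \<Rightarrow> 'a) set" where
  "succ_product S = (\<Pi>\<^sub>E \<delta>\<in>S. {..<card_succ \<delta>})"

definition scale :: "'a::wellorder \<Rightarrow> 'a set \<Rightarrow> ('a \<Rightarrow> 'a \<Rightarrow> 'a) \<Rightarrow> bool" where
  "scale \<kappa> S f \<longleftrightarrow>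
     (\<forall>\<alpha><card_succ \<kappa>. f \<alpha> \<in> succ_product S) \<and>
     (\<forall>\<alpha><card_succ \<kappa>. \<forall>\<beta><\<alpha>. less_star S (f \<beta>) (f \<alpha>)) \<and>
     (\<forall>g\<in>succ_product S. \<exists>\<alpha><card_succ \<kappa>. less_star S g (f \<alpha>))"

definition good_point :: "'a::wellorder set \<Rightarrow> ('a \<Rightarrow> 'a \<Rightarrow> 'a) \<Rightarrow> 'a \<Rightarrow> bool" where
  "good_point S f \<alpha> \<longleftrightarrow>
     (\<exists>A. unbounded_in \<alpha> A \<and> order_type A = cof \<alpha> \<and>
        (\<exists>j\<in>S. \<forall>i\<in>S. j \<le> i \<longrightarrow> strict_mono_on A (\<lambda>\<beta>. f \<beta> i)))"

definition good_scale :: "'a::wellorder \<Rightarrow> 'a set \<Rightarrow> ('a \<Rightarrow> 'a \<Rightarrow> 'a) \<Rightarrow> bool" where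
  "good_scale \<kappa> S f \<longleftrightarrow> scale \<kappa> S f \<and>
     (\<exists>D. club (card_succ \<kappa>) D \<and> (\<forall>\<alpha>\<in>D. cof \<kappa> < cof \<alpha> \<longrightarrow> good_point S f \<alpha>))"

end

theory Submission
  imports Defs
begin

text \<open>
  It suffices to find, for each limit \<open>\<alpha> < \<kappa>\<^sup>+\<close>, a club \<open>C \<alpha>\<close> of size less than \<open>\<kappa>\<close> and, for each \<open>\<beta> < \<kappa>\<^sup>+\<close>, a family
  of at most \<open>\<kappa>\<close> sets of size less than \<open>\<kappa>\<close> such that \<open>C \<alpha> \<inter> \<beta>\<close> is covered by a member of the family
  of \<open>\<beta>\<close> for all limit points \<open>\<beta>\<close> of \<open>C \<alpha>\<close>: as \<open>\<kappa>\<close> is a strong limit, the subsets of the covering sets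
  form the weak square sequence. Replace \<open>S\<close> by its intersection with a club of order type \<open>cof \<kappa>\<close>.

  At a good point \<open>\<alpha>\<close> with \<open>cof \<kappa> < cof \<alpha>\<close>, the functions \<open>f \<beta>\<close> with \<open>\<beta> < \<alpha>\<close> have an exact upper bound \<open>g\<close>.
  Choose \<open>E \<delta>\<close> in the weak square sequence of \<open>\<delta>\<close> at \<open>g \<delta>\<close>, and let \<open>C \<alpha>\<close> consist of points \<open>\<xi>\<close> such that
  the functions \<open>f \<eta>\<close> with \<open>\<eta> < \<xi>\<close> are cofinally interleaved with \<open>E\<close>. For \<open>\<beta> < \<alpha>\<close>, the set \<open>E \<delta> \<inter> f \<beta> \<delta>\<close>
  is one of at most \<open>\<delta>\<close> traces; pressing down bounds its index and its size on an unbounded \<open>T \<subseteq> S\<close>. The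
  points below \<open>\<beta>\<close> interleaved with these traces on \<open>T\<close> cover \<open>C \<alpha> \<inter> \<beta>\<close>, and there are only \<open>\<kappa>\<close> many choices
  of \<open>T\<close> and of bounded indices. If \<open>cof \<alpha> \<le> cof \<kappa>\<close>, then the proper initial segments of a club of type
  \<open>cof \<alpha>\<close> are covered by the preimages of ordinals below \<open>\<kappa>\<close> under an injection of \<open>\<beta>\<close> into \<open>\<kappa>\<close>, and points
  outside the club \<open>D\<close> of the good scale are handled in each gap of \<open>D\<close> separately.
\<close>

section \<open>Comparison of cardinalities\<close>

lemma not_lesspoll_imp_lepoll:
  assumes "\<not> A \<prec> B"
  shows "B \<lesssim> A"
proof -
  have "(card_of A, card_of B) \<in> ordLeq \<or> (card_of B, card_of A) \<in> ordLeq"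
    by (rule ordLeq_total) (rule card_of_Well_order)+
  then have "A \<lesssim> B \<or> B \<lesssim> A"
    by (simp add: lepoll_def flip: card_of_ordLeq)
  with assms show ?thesis
    by (auto simp: lesspoll_def intro: eqpoll_imp_lepoll eqpoll_sym)
qed

lemma infinite_times_self_lepoll:
  assumes "infinite A"
  shows "A \<times> A \<lesssim> A"
  using card_of_Times_same_infinite[OF assms]
  by (simp add: eqpoll_iff_card_of_ordIso eqpoll_imp_lepoll)

lemma UN_lepoll_infinite:
  assumes "infinite K" "I \<lesssim> K" "\<And>i. i \<in> I \<Longrightarrow> A i \<lesssim> K"
  shows "(\<Union>i\<in>I. A i) \<lesssim> K"
proof -
  have "\<forall>i\<in>I. \<exists>g. A i \<subseteq> g ` K"
    using assms(3) by (simp add: lepoll_iff)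
  then obtain g where g: "\<And>i. i \<in> I \<Longrightarrow> A i \<subseteq> g i ` K"
    by metis
  have "(\<Union>i\<in>I. A i) \<subseteq> (\<lambda>(i, k). g i k) ` (I \<times> K)"
    using g by fastforce
  then have "(\<Union>i\<in>I. A i) \<lesssim> I \<times> K"
    by (rule subset_image_lepoll)
  also have "\<dots> \<lesssim> K \<times> K"
    using assms(2) by (simp add: times_lepoll_mono)
  also have "\<dots> \<lesssim> K"
    using assms(1) by (rule infinite_times_self_lepoll)
  finally show ?thesis .
qed

lemma Un_lepoll_infinite:
  assumes "infinite K" "A \<lesssim> K" "B \<lesssim> K"
  shows "A \<union> B \<lesssim> K"
proof -
  have "(\<Union>i\<in>{True, False}. if i then A else B) \<lesssim> K"
    by (rule UN_lepoll_infinite) (use assms in \<open>auto intro: finite_lepoll_infinite\<close>)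
  then show ?thesis
    by (simp add: Un_commute)
qed

section \<open>Order types\<close>

lemma strict_mono_on_self_le:
  fixes g :: "'a::wellorder \<Rightarrow> 'a"
  assumes "strict_mono_on {..<\<theta>} g" "x < \<theta>"
  shows "x \<le> g x"
  using assms(2)
proof (induction x rule: less_induct)
  case (less x)
  show ?case
  proof (rule ccontr)
    assume "\<not> x \<le> g x"
    then have lt: "g x < x" by simp
    then have "g (g x) < g x"
      using assms(1) less.prems by (meson lessThan_iff order.strict_trans strict_mono_onD)
    moreover have "g x \<le> g (g x)"
      using less.IH[OF lt] lt less.prems by simp
    ultimately show False by simp
  qed
qed

lemma strict_mono_on_le:
  fixes g :: "'a::wellorder \<Rightarrow> 'a"
  assumes "strict_mono_on {..<\<theta>} g" "g ` {..<\<theta>} \<subseteq> {..<\<theta>'}"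
  shows "\<theta> \<le> \<theta>'"
  using strict_mono_on_self_le[OF assms(1)] assms(2)
  by (metis image_subset_iff leI lessThan_iff order.strict_trans1 order_less_irrefl)

text \<open>\<open>order_type\<close> selects its ordinal from this relation by a definite
  description; with \<open>h\<close> exposed, uniqueness and bounds can be proved first.\<close>

definition enumerates :: "('a::wellorder \<Rightarrow> 'a) \<Rightarrow> 'a \<Rightarrow> 'a set \<Rightarrow> bool" where
  "enumerates h \<theta> A \<longleftrightarrow> bij_betw h {..<\<theta>} A \<and> strict_mono_on {..<\<theta>} h"

text \<open>Composing \<open>r\<close> with \<open>h\<close> gives a strictly increasing map between
  ordinals, and such a map never falls below the identity.\<close>

lemma enumerates_le:
  assumes h: "enumerates h \<theta> A" and r: "strict_mono_on A r" "r ` A \<subseteq> {..<\<theta>'}"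
  shows "\<theta> \<le> \<theta>'"
proof (rule strict_mono_on_le)
  show "strict_mono_on {..<\<theta>} (r \<circ> h)"
    using h r(1) unfolding enumerates_def strict_mono_on_def bij_betw_def by auto
  show "(r \<circ> h) ` {..<\<theta>} \<subseteq> {..<\<theta>'}"
    using h r(2) unfolding enumerates_def bij_betw_def by auto
qed

lemma enumerates_unique:
  assumes "enumerates h \<theta> A" "enumerates h' \<theta>' A"
  shows "\<theta> = \<theta>'"
proof -
  have "\<theta>1 \<le> \<theta>2" if "enumerates h1 \<theta>1 A" "enumerates h2 \<theta>2 A" for h1 h2 \<theta>1 \<theta>2
  proof (rule enumerates_le[OF that(1)])
    let ?r = "the_inv_into {..<\<theta>2} h2"
    have bij: "bij_betw ?r A {..<\<theta>2}"
      using that(2) unfolding enumerates_def by (simp add: bij_betw_the_inv_into)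
    then show "?r ` A \<subseteq> {..<\<theta>2}"
      by (simp add: bij_betw_def)
    have inv: "h2 (?r a) = a" if "a \<in> A" for a
      using \<open>enumerates h2 \<theta>2 A\<close> that unfolding enumerates_def by (metis bij_betw_def f_the_inv_into_f)
    show "strict_mono_on A ?r"
    proof (rule strict_mono_onI)
      fix a b assume ab: "a \<in> A" "b \<in> A" "a < b"
      show "?r a < ?r b"
      proof (rule ccontr)
        assume "\<not> ?r a < ?r b"
        then have "h2 (?r b) \<le> h2 (?r a)"
          using that(2) bij ab unfolding enumerates_def bij_betw_def
          by (metis image_eqI leI lessThan_iff order.order_iff_strict strict_mono_onD)
        then show False using inv ab by simp
      qed
    qed
  qed
  then show ?thesis
    using assms by (meson order_antisym)
qed

text \<open>The rank of an element of \<open>A\<close> among its predecessors in \<open>A\<close> inverts the enumeration; its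
  values form an initial segment.\<close>

lemma ex_enumerates:
  fixes A :: "'a::wellorder set"
  assumes "A \<subseteq> {..<\<alpha>}"
  shows "\<exists>h \<theta>. enumerates h \<theta> A \<and> \<theta> \<le> \<alpha>"
proof -
  \<comment> \<open>The rank of \<open>a\<close> is the least strict upper bound of the ranks of the
    earlier members of \<open>A\<close>.\<close>
  define r :: "'a \<Rightarrow> 'a" where "r = wfrec {(x, y). x < y} (\<lambda>r a. LEAST x. \<forall>b\<in>A. b < a \<longrightarrow> r b < x)"
  have wf: "wf {(x, y::'a). x < y}"
    by (rule wf)
  have r: "r a = (LEAST x. \<forall>b\<in>A. b < a \<longrightarrow> r b < x)" for a
  proof -
    have "r a = (LEAST x. \<forall>b\<in>A. b < a \<longrightarrow> cut r {(x, y). x < y} a b < x)"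
      unfolding r_def by (subst wfrec[OF wf]) simp
    also have "\<dots> = (LEAST x. \<forall>b\<in>A. b < a \<longrightarrow> r b < x)"
      by (rule arg_cong[where f = Least]) (auto simp: cut_def fun_eq_iff)
    finally show ?thesis .
  qed
  have le: "r a \<le> a" for a
  proof (induction a rule: less_induct)
    case (less a)
    then have "\<forall>b\<in>A. b < a \<longrightarrow> r b < a"
      by (meson order_le_less_trans)
    then show ?case
      unfolding r[of a] by (rule Least_le[where P = "\<lambda>x. \<forall>b\<in>A. b < a \<longrightarrow> r b < x"])
  qed
  have mono: "r b < r a" if "b \<in> A" "b < a" for a b
  proof -
    have "\<forall>b\<in>A. b < a \<longrightarrow> r b < a"
      using le by (meson order_le_less_trans)
    then have "\<forall>b\<in>A. b < a \<longrightarrow> r b < r a"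
      unfolding r[of a] by (rule LeastI[where P = "\<lambda>x. \<forall>b\<in>A. b < a \<longrightarrow> r b < x"])
    with that show ?thesis by blast
  qed
  have down: "\<exists>b\<in>A. r b = y" if "a \<in> A" "y < r a" for a y
    using that
  proof (induction a rule: less_induct)
    case (less a)
    have "\<not> (\<forall>b\<in>A. b < a \<longrightarrow> r b < y)"
      using less.prems(2) not_less_Least[of y "\<lambda>x. \<forall>b\<in>A. b < a \<longrightarrow> r b < x"] r[of a] by simp
    then obtain b where b: "b \<in> A" "b < a" "y \<le> r b"
      by (meson leI)
    then show ?case
      using less.IH[of b] by (cases "y = r b") auto
  qed
  \<comment> \<open>Since \<open>r a \<le> a\<close>, the ordinal \<alpha> is not a rank, so a first
    ordinal that is not a rank exists in the type and is at most \<alpha>.\<close>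
  define \<theta> where "\<theta> = (LEAST x. x \<notin> r ` A)"
  have \<alpha>: "\<alpha> \<notin> r ` A"
    using le assms by (metis imageE lessThan_iff not_le subsetD)
  have "\<theta> \<notin> r ` A" "\<theta> \<le> \<alpha>"
    unfolding \<theta>_def using \<alpha> by (fact LeastI[of "\<lambda>x. x \<notin> r ` A"], fact Least_le[of "\<lambda>x. x \<notin> r ` A"])
  have img: "r ` A = {..<\<theta>}"
  proof (intro equalityI subsetI)
    fix y assume "y \<in> r ` A"
    then obtain a where a: "a \<in> A" "y = r a" by blast
    show "y \<in> {..<\<theta>}"
    proof (rule ccontr)
      assume "y \<notin> {..<\<theta>}"
      then have "\<theta> < r a \<or> \<theta> = r a" using a by auto
      then show False
        using down[OF a(1)] \<open>\<theta> \<notin> r ` A\<close> a(1) by blast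
    qed
  next
    fix y assume "y \<in> {..<\<theta>}"
    then show "y \<in> r ` A"
      using not_less_Least[of y "\<lambda>x. x \<notin> r ` A"] unfolding \<theta>_def by blast
  qed
  have inj: "inj_on r A"
    using mono by (intro linorder_inj_onI') (metis order_less_irrefl)
  have "enumerates (the_inv_into A r) \<theta> A"
    unfolding enumerates_def
  proof
    show "bij_betw (the_inv_into A r) {..<\<theta>} A"
      using inj img by (simp add: bij_betw_def bij_betw_the_inv_into inj_on_the_inv_into flip: img)
    show "strict_mono_on {..<\<theta>} (the_inv_into A r)"
    proof (rule strict_mono_onI)
      fix x y assume xy: "x \<in> {..<\<theta>}" "y \<in> {..<\<theta>}" "x < y"
      then obtain a b where ab: "a \<in> A" "b \<in> A" "x = r a" "y = r b"
        using img by blast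
      then have "a < b"
        using mono[of b a] xy(3) by (metis less_asym' linorder_less_linear)
      then show "the_inv_into A r x < the_inv_into A r y"
        using ab inj by (simp add: the_inv_into_f_f)
    qed
  qed
  with \<open>\<theta> \<le> \<alpha>\<close> show ?thesis by blast
qed

lemma order_type_eqI:
  assumes "enumerates h \<theta> A"
  shows "order_type A = \<theta>"
  unfolding order_type_def
proof (rule the_equality)
  show "\<exists>h. bij_betw h {..<\<theta>} A \<and> strict_mono_on {..<\<theta>} h"
    using assms unfolding enumerates_def by blast
next
  fix \<theta>' :: 'a assume "\<exists>h. bij_betw h {..<\<theta>'} A \<and> strict_mono_on {..<\<theta>'} h"
  then show "\<theta>' = \<theta>"
    using assms by (metis enumerates_def enumerates_unique)
qed

lemma enumerates_order_type:
  assumes "A \<subseteq> {..<\<alpha>}"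
  obtains h where "enumerates h (order_type A) A" "order_type A \<le> \<alpha>"
  using ex_enumerates[OF assms] order_type_eqI that by metis

lemma order_type_le_strict_mono:
  assumes "A \<subseteq> {..<\<alpha>}" "strict_mono_on A r" "r ` A \<subseteq> {..<\<theta>}"
  shows "order_type A \<le> \<theta>"
proof -
  obtain h where "enumerates h (order_type A) A"
    using enumerates_order_type[OF assms(1)] .
  then show ?thesis
    using assms(2,3) by (rule enumerates_le)
qed

lemma order_type_eqpoll:
  assumes "A \<subseteq> {..<\<alpha>}"
  shows "{..<order_type A} \<approx> A"
proof -
  obtain h where "enumerates h (order_type A) A"
    using enumerates_order_type[OF assms] .
  then show ?thesis
    unfolding enumerates_def eqpoll_def by blast
qed

lemma cardinal_lesspoll_iff:
  fixes \<mu> :: "'a::wellorder"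
  assumes "is_cardinal \<mu>"
  shows "{..<\<theta>} \<prec> {..<\<mu>} \<longleftrightarrow> \<theta> < \<mu>"
proof
  assume "{..<\<theta>} \<prec> {..<\<mu>}"
  then show "\<theta> < \<mu>"
    by (meson lesspoll_trans1 lesspoll_not_refl lessThan_subset_iff not_le subset_imp_lepoll
        lesspoll_trans2)
qed (use assms is_cardinal_def in blast)

lemma order_type_less_cardinal:
  assumes "is_cardinal \<mu>" "A \<subseteq> {..<\<alpha>}" "A \<prec> {..<\<mu>}"
  shows "order_type A < \<mu>"
  using eq_lesspoll_trans[OF order_type_eqpoll[OF assms(2)] assms(3)]
  by (simp add: cardinal_lesspoll_iff[OF assms(1)])

section \<open>Cofinality, clubs and pressing down\<close>

lemma limit_ordinalD: "limit_ordinal \<alpha> \<Longrightarrow> \<beta> < \<alpha> \<Longrightarrow> \<exists>\<gamma><\<alpha>. \<beta> < \<gamma>"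
  by (simp add: limit_ordinal_def)

lemma cof_le: "unbounded_in \<alpha> A \<Longrightarrow> cof \<alpha> \<le> order_type A"
  unfolding cof_def by (rule Least_le) blast

lemma cof_attained:
  obtains A where "unbounded_in \<alpha> A" "order_type A = cof \<alpha>"
proof -
  have "unbounded_in \<alpha> {..<\<alpha>}"
    by (auto simp: unbounded_in_def)
  then have "\<exists>\<theta> A. unbounded_in \<alpha> A \<and> order_type A = \<theta>"
    by blast
  then show ?thesis
    using that LeastI_ex[of "\<lambda>\<theta>. \<exists>A. unbounded_in \<alpha> A \<and> order_type A = \<theta>"]
    unfolding cof_def by blast
qed

lemma enumerates_cofinal:
  assumes "unbounded_in \<alpha> A" "order_type A = \<theta>"
  obtains h where "strict_mono_on {..<\<theta>} h" "h ` {..<\<theta>} = A"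
  using assms enumerates_order_type[of A \<alpha>]
  unfolding unbounded_in_def enumerates_def bij_betw_def by metis

lemma cof_le_self: "cof \<alpha> \<le> \<alpha>"
proof -
  have "unbounded_in \<alpha> {..<\<alpha>}"
    by (auto simp: unbounded_in_def)
  then have "cof \<alpha> \<le> order_type {..<\<alpha>}"
    by (rule cof_le)
  also have "\<dots> \<le> \<alpha>"
    by (rule order_type_le_strict_mono[of _ \<alpha> "\<lambda>x. x"]) (auto simp: strict_mono_on_def)
  finally show ?thesis .
qed

text \<open>A cofinal map need not be increasing. It is increasing on the indices where it exceeds
  all earlier values, and its range stays cofinal there because the first index that reaches a given
  \<beta> is of this kind.\<close>

lemma cof_le_cofinal_map:
  fixes g :: "'a::wellorder \<Rightarrow> 'a"
  assumes g: "\<And>i. i < \<theta> \<Longrightarrow> g i < \<alpha>" and cofinal: "\<And>\<beta>. \<beta> < \<alpha> \<Longrightarrow> \<exists>i<\<theta>. \<beta> \<le> g i"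
  shows "cof \<alpha> \<le> \<theta>"
proof -
  define R where "R = {i. i < \<theta> \<and> (\<forall>i'<i. g i' < g i)}"
  have mono: "strict_mono_on R g"
    by (auto simp: R_def strict_mono_on_def)
  then have inj: "inj_on g R"
    by (rule strict_mono_on_imp_inj_on)
  have "unbounded_in \<alpha> (g ` R)"
    unfolding unbounded_in_def
  proof (intro conjI allI impI)
    show "g ` R \<subseteq> {..<\<alpha>}"
      using g by (auto simp: R_def)
  next
    fix \<beta> assume "\<beta> < \<alpha>"
    then obtain i where i: "i < \<theta>" "\<beta> \<le> g i"
      using cofinal by blast
    define k where "k = (LEAST k. \<beta> \<le> g k)"
    have k: "\<beta> \<le> g k" "k \<le> i"
      using LeastI[of "\<lambda>k. \<beta> \<le> g k", OF i(2)] Least_le[of "\<lambda>k. \<beta> \<le> g k", OF i(2)]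
      unfolding k_def by auto
    have "g k' < g k" if "k' < k" for k'
      using not_less_Least[of k' "\<lambda>k. \<beta> \<le> g k"] that k(1) unfolding k_def by simp
    then have "k \<in> R"
      using k(2) i(1) by (auto simp: R_def)
    then show "\<exists>\<gamma>\<in>g ` R. \<beta> \<le> \<gamma>"
      using k(1) by blast
  qed
  then have "cof \<alpha> \<le> order_type (g ` R)"
    by (rule cof_le)
  also have "\<dots> \<le> \<theta>"
  proof (rule order_type_le_strict_mono)
    show "g ` R \<subseteq> {..<\<alpha>}"
      using g by (auto simp: R_def)
    show "strict_mono_on (g ` R) (the_inv_into R g)"
    proof (rule strict_mono_onI)
      fix x y assume "x \<in> g ` R" "y \<in> g ` R" "x < y"
      then obtain i k where "i \<in> R" "k \<in> R" "x = g i" "y = g k" "g i < g k"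
        by blast
      then show "the_inv_into R g x < the_inv_into R g y"
        using strict_mono_on_less[OF mono, of i k] inj by (simp add: the_inv_into_f_f)
    qed
    show "the_inv_into R g ` g ` R \<subseteq> {..<\<theta>}"
      using inj by (auto simp: the_inv_into_f_f R_def)
  qed
  finally show ?thesis .
qed

lemma bounded_of_lepoll_cof:
  fixes \<alpha> :: "'a::wellorder"
  assumes "X \<lesssim> {..<\<theta>}" "\<theta> < cof \<alpha>" "X \<subseteq> {..<\<alpha>}"
  shows "\<exists>\<beta><\<alpha>. \<forall>x\<in>X. x < \<beta>"
proof (rule ccontr)
  assume unb: "\<not> ?thesis"
  obtain g where g: "X \<subseteq> g ` {..<\<theta>}"
    using assms(1) unfolding lepoll_iff by blast
  have "\<theta> < \<alpha>"
    using assms(2) cof_le_self by (rule less_le_trans)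
  have "cof \<alpha> \<le> \<theta>"
  proof (rule cof_le_cofinal_map)
    fix i assume "i < \<theta>"
    \<comment> \<open>Indices that \<open>g\<close> sends outside \<open>X\<close> get the value
      \<theta>, which is below \<alpha> because cofinalities never exceed their ordinal.\<close>
    show "(if g i \<in> X then g i else \<theta>) < \<alpha>"
      using assms(3) \<open>\<theta> < \<alpha>\<close> by auto
  next
    fix \<beta> assume "\<beta> < \<alpha>"
    then obtain x where "x \<in> X" "\<beta> \<le> x"
      using unb not_less by blast
    moreover then obtain i where "i < \<theta>" "x = g i"
      using g by blast
    ultimately show "\<exists>i<\<theta>. \<beta> \<le> (if g i \<in> X then g i else \<theta>)"
      by auto
  qed
  with assms(2) show False by simp
qed

section \<open>Uncountable cofinality and clubs of closure points\<close>

definition uncountable_cof :: "'a::wellorder \<Rightarrow> bool" where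
  "uncountable_cof \<alpha> \<longleftrightarrow> (\<forall>g::nat \<Rightarrow> 'a. (\<forall>n. g n < \<alpha>) \<longrightarrow> (\<exists>\<beta><\<alpha>. \<forall>n. g n < \<beta>))"

lemma infinite_omega:
  assumes "infinite {..<\<alpha>::'a::wellorder}"
  shows "infinite {..<omega::'a}"
  unfolding omega_def using assms by (rule LeastI)

text \<open>As \<alpha> is infinite, \<open>omega\<close> really is an infinite ordinal, so the
  range of a sequence embeds in it and is bounded by the definition of cofinality.\<close>

lemma uncountable_cofI:
  fixes \<alpha> :: "'a::wellorder"
  assumes "infinite {..<\<alpha>}" "omega < cof \<alpha>"
  shows "uncountable_cof \<alpha>"
  unfolding uncountable_cof_def
proof (intro allI impI)
  fix g :: "nat \<Rightarrow> 'a" assume "\<forall>n. g n < \<alpha>"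
  then have "range g \<subseteq> {..<\<alpha>}" by auto
  moreover have "range g \<lesssim> {..<omega::'a}"
    using infinite_omega[OF assms(1)] image_lepoll lepoll_trans unfolding infinite_le_lepoll by blast
  ultimately show "\<exists>\<beta><\<alpha>. \<forall>n. g n < \<beta>"
    using bounded_of_lepoll_cof[OF _ assms(2)] by fastforce
qed

lemma uncountable_cof_greater:
  assumes "uncountable_cof \<alpha>" "\<beta> < \<alpha>"
  shows "\<exists>\<gamma><\<alpha>. \<beta> < \<gamma>"
  using assms unfolding uncountable_cof_def by (auto dest: spec[of _ "\<lambda>_. \<beta>"])

text \<open>Closure points of a relation, which replaces a function so that nothing has to be
  chosen. Only limit ordinals qualify, since \<zeta> lies strictly between \<eta> and \<xi>.\<close>

definition catch_up :: "'a::wellorder \<Rightarrow> ('a \<Rightarrow> 'a \<Rightarrow> bool) \<Rightarrow> 'a set" where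
  "catch_up \<alpha> R = {\<xi>. \<xi> < \<alpha> \<and> {..<\<xi>} \<noteq> {} \<and> (\<forall>\<eta><\<xi>. \<exists>\<zeta><\<xi>. \<eta> < \<zeta> \<and> R \<eta> \<zeta>)}"

lemma catch_upD:
  assumes "\<xi> \<in> catch_up \<alpha> R"
  shows "\<xi> < \<alpha>" "{..<\<xi>} \<noteq> {}" "\<And>\<eta>. \<eta> < \<xi> \<Longrightarrow> \<exists>\<zeta><\<xi>. \<eta> < \<zeta> \<and> R \<eta> \<zeta>"
  using assms by (simp_all add: catch_up_def)

text \<open>Iterating a choice of successors \<omega> times from \<gamma> gives a sequence whose
  supremum is below \<alpha> by uncountable cofinality. It is a closure point because
  \<open>R\<close> passes to smaller first arguments.\<close>

lemma club_catch_up: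
  assumes cc: "uncountable_cof \<alpha>"
    and ex: "\<And>\<xi>. \<xi> < \<alpha> \<Longrightarrow> \<exists>\<zeta><\<alpha>. \<xi> < \<zeta> \<and> R \<xi> \<zeta>"
    and mono: "\<And>\<xi> \<eta> \<zeta>. \<eta> \<le> \<xi> \<Longrightarrow> \<xi> < \<zeta> \<Longrightarrow> \<zeta> < \<alpha> \<Longrightarrow> R \<xi> \<zeta> \<Longrightarrow> R \<eta> \<zeta>"
  shows "club \<alpha> (catch_up \<alpha> R)"
proof -
  have "\<exists>\<xi>\<in>catch_up \<alpha> R. \<gamma> \<le> \<xi>" if "\<gamma> < \<alpha>" for \<gamma>
  proof -
    obtain nx where nxt: "\<And>\<xi>. \<xi> < \<alpha> \<Longrightarrow> nx \<xi> < \<alpha> \<and> \<xi> < nx \<xi> \<and> R \<xi> (nx \<xi>)"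
      using ex by metis
    define g where "g n = (nx ^^ n) \<gamma>" for n
    have g: "g n < \<alpha>" for n
      by (induction n) (auto simp: g_def that nxt)
    have gS: "g (Suc n) = nx (g n)" for n
      by (simp add: g_def)
    obtain \<beta> where \<beta>: "\<beta> < \<alpha>" "\<forall>n. g n < \<beta>"
      using cc g unfolding uncountable_cof_def by blast
    define \<xi> where "\<xi> = (LEAST \<xi>. \<forall>n. g n < \<xi>)"
    have \<xi>: "g n < \<xi>" for n
      using LeastI[of "\<lambda>\<xi>. \<forall>n. g n < \<xi>" \<beta>] \<beta> unfolding \<xi>_def by blast
    have "\<xi> < \<alpha>"
      using Least_le[of "\<lambda>\<xi>. \<forall>n. g n < \<xi>" \<beta>] \<beta> unfolding \<xi>_def by fastforce
    have "\<exists>\<zeta><\<xi>. \<eta> < \<zeta> \<and> R \<eta> \<zeta>" if "\<eta> < \<xi>" for \<eta>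
    proof -
      have "\<not> (\<forall>n. g n < \<eta>)"
        using not_less_Least[of \<eta> "\<lambda>\<xi>. \<forall>n. g n < \<xi>"] that unfolding \<xi>_def by blast
      then obtain n where n: "\<eta> \<le> g n"
        by (auto simp: not_less)
      have "R \<eta> (g (Suc n))"
        using mono[OF n, of "g (Suc n)"] nxt[OF g[of n]] g by (simp add: gS)
      moreover have "\<eta> < g (Suc n)"
        using n nxt[OF g[of n]] unfolding gS by (metis le_less_trans)
      ultimately show ?thesis
        using \<xi> by blast
    qed
    then have "\<xi> \<in> catch_up \<alpha> R"
      using \<open>\<xi> < \<alpha>\<close> \<xi>[of 0] by (auto simp: catch_up_def)
    moreover have "\<gamma> \<le> \<xi>"
      using \<xi>[of 0] by (simp add: g_def)
    ultimately show ?thesis by blast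
  qed
  moreover have "\<beta> \<in> catch_up \<alpha> R" if "\<beta> < \<alpha>" "limit_point (catch_up \<alpha> R) \<beta>" for \<beta>
  proof -
    have "\<exists>\<zeta><\<beta>. \<eta> < \<zeta> \<and> R \<eta> \<zeta>" if \<eta>: "\<eta> < \<beta>" for \<eta>
    proof -
      obtain \<xi> where "\<xi> \<in> catch_up \<alpha> R" "\<eta> < \<xi>" "\<xi> < \<beta>"
        using \<open>limit_point (catch_up \<alpha> R) \<beta>\<close> \<eta> unfolding limit_point_def by blast
      then show ?thesis
        unfolding catch_up_def by (auto intro: order.strict_trans)
    qed
    then show ?thesis
      using that unfolding catch_up_def limit_point_def by blast
  qed
  ultimately show ?thesis
    unfolding club_def unbounded_in_def by (auto simp: catch_up_def)
qed

text \<open>Such an \<open>R\<close> makes every closure point a limit point of \<open>C\<close>.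
  Clubs are thereby intersected by adding a conjunct to the relation.\<close>

lemma club_catch_up_subset:
  assumes "club \<alpha> C" "\<And>\<eta> \<zeta>. R \<eta> \<zeta> \<Longrightarrow> \<exists>c\<in>C. \<eta> < c \<and> c < \<zeta>"
  shows "catch_up \<alpha> R \<subseteq> C"
proof
  fix \<xi> assume \<xi>: "\<xi> \<in> catch_up \<alpha> R"
  have "\<exists>c\<in>C. \<eta> < c \<and> c < \<xi>" if \<eta>: "\<eta> < \<xi>" for \<eta>
  proof -
    obtain \<zeta> where \<zeta>: "\<zeta> < \<xi>" "R \<eta> \<zeta>"
      using catch_upD(3)[OF \<xi> \<eta>] by blast
    then obtain c where "c \<in> C" "\<eta> < c" "c < \<zeta>"
      using assms(2) by blast
    with \<zeta>(1) show ?thesis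
      by (intro bexI[of _ c]) auto
  qed
  then have "limit_point C \<xi>"
    using catch_upD(2)[OF \<xi>] by (simp add: limit_point_def)
  then show "\<xi> \<in> C"
    using assms(1) catch_upD(1)[OF \<xi>] by (simp add: club_def)
qed

text \<open>Fodor's lemma in the form available below a singular cardinal, where a regressive function need
  not be constant on a large set.\<close>

lemma pressing_down:
  assumes cc: "uncountable_cof \<kappa>" and S: "stationary \<kappa> S" and E: "club \<kappa> E" and j: "j < \<kappa>"
    and regr: "\<And>\<delta>. \<delta> \<in> S \<inter> E \<Longrightarrow> j \<le> \<delta> \<Longrightarrow> i \<delta> < \<delta>"
  shows "\<exists>\<rho><\<kappa>. \<forall>\<gamma><\<kappa>. \<exists>\<delta>\<in>S \<inter> E. \<gamma> \<le> \<delta> \<and> j \<le> \<delta> \<and> i \<delta> \<le> \<rho>"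
proof (rule ccontr)
  assume neg: "\<not> ?thesis"
  \<comment> \<open>From \<zeta> on, \<open>i\<close> exceeds \<eta> on \<open>S \<inter> E\<close>;
    the other conjuncts force closure points into \<open>E\<close> and above \<open>j\<close>. At a
    closure point \<delta> in \<open>S\<close>, the choice of \<open>i \<delta>\<close> as \<eta>
    gives \<open>i \<delta> < i \<delta>\<close>.\<close>
  define R where "R \<eta> \<zeta> \<longleftrightarrow> (\<exists>c\<in>E. \<eta> < c \<and> c < \<zeta>) \<and> j < \<zeta> \<and>
    (\<forall>\<delta>\<in>S \<inter> E. \<zeta> \<le> \<delta> \<longrightarrow> \<eta> < i \<delta>)" for \<eta> \<zeta>
  have "club \<kappa> (catch_up \<kappa> R)"
  proof (rule club_catch_up[OF cc])
    fix \<xi> assume \<xi>: "\<xi> < \<kappa>"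
    obtain \<gamma> where \<gamma>: "\<gamma> < \<kappa>" "\<forall>\<delta>\<in>S \<inter> E. \<gamma> \<le> \<delta> \<and> j \<le> \<delta> \<longrightarrow> \<xi> < i \<delta>"
      using neg \<xi> by (meson not_le)
    obtain \<xi>' where "\<xi>' < \<kappa>" "\<xi> < \<xi>'"
      using uncountable_cof_greater[OF cc \<xi>] by blast
    then obtain c where c: "c \<in> E" "\<xi> < c" "c < \<kappa>"
      using E unfolding club_def unbounded_in_def by (meson less_le_trans lessThan_iff subsetD)
    have "max c (max \<gamma> j) < \<kappa>"
      using c \<gamma> j by simp
    then obtain \<zeta> where \<zeta>: "\<zeta> < \<kappa>" "max c (max \<gamma> j) < \<zeta>"
      using uncountable_cof_greater[OF cc] by blast
    then have "R \<xi> \<zeta>"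
      unfolding R_def using c \<gamma> by (auto simp: less_imp_le order_trans[OF less_imp_le])
    then show "\<exists>\<zeta><\<kappa>. \<xi> < \<zeta> \<and> R \<xi> \<zeta>"
      using \<zeta> c by auto
  next
    fix \<xi> \<eta> \<zeta> assume "\<eta> \<le> \<xi>" "\<xi> < \<zeta>" "\<zeta> < \<kappa>" "R \<xi> \<zeta>"
    then show "R \<eta> \<zeta>"
      unfolding R_def by (meson order_le_less_trans)
  qed
  then obtain \<delta> where \<delta>: "\<delta> \<in> S" "\<delta> \<in> catch_up \<kappa> R"
    using S unfolding stationary_def by blast
  have "\<delta> \<in> E"
    using club_catch_up_subset[OF E, of R] \<delta>(2) unfolding R_def by blast
  have lim: "\<exists>\<zeta><\<delta>. R \<eta> \<zeta>" if "\<eta> < \<delta>" for \<eta>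
    using catch_upD(3)[OF \<delta>(2) that] by blast
  have "j \<le> \<delta>"
  proof -
    obtain \<eta> where "\<eta> < \<delta>"
      using catch_upD(2)[OF \<delta>(2)] by blast
    then obtain \<zeta> where "\<zeta> < \<delta>" "R \<eta> \<zeta>"
      using lim by blast
    then show ?thesis
      by (auto simp: R_def)
  qed
  then have "i \<delta> < \<delta>"
    using regr \<delta>(1) \<open>\<delta> \<in> E\<close> by simp
  then obtain \<zeta> where "\<zeta> < \<delta>" "R (i \<delta>) \<zeta>"
    using lim by blast
  then show False
    unfolding R_def using \<delta>(1) \<open>\<delta> \<in> E\<close> by (metis IntI less_imp_le order_less_irrefl)
qed

text \<open>Taking strict suprema of initial segments makes a cofinal enumeration continuous.\<close>

lemma ex_cofinal_club:
  assumes "limit_ordinal \<alpha>"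
  shows "\<exists>s. strict_mono_on {..<cof \<alpha>} s \<and> club \<alpha> (s ` {..<cof \<alpha>})"
proof -
  obtain A where A: "unbounded_in \<alpha> A" "order_type A = cof \<alpha>"
    by (rule cof_attained)
  obtain h where h: "strict_mono_on {..<cof \<alpha>} h" "h ` {..<cof \<alpha>} = A"
    using enumerates_cofinal[OF A] .
  define s where "s i = (LEAST x. \<forall>j<i. h j < x)" for i
  have above: "h j < s i" if "i < cof \<alpha>" "j < i" for i j
  proof -
    have "\<forall>j<i. h j < h i"
      using h(1) that(1) by (auto simp: strict_mono_on_def intro: order.strict_trans)
    then have "\<forall>j<i. h j < s i"
      unfolding s_def by (rule LeastI[where P = "\<lambda>x. \<forall>j<i. h j < x"])
    with that(2) show ?thesis by blast
  qed
  have s_le: "s i \<le> x" if "\<forall>j<i. h j < x" for i x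
    unfolding s_def using that by (rule Least_le[where P = "\<lambda>x. \<forall>j<i. h j < x"])
  have s_le_h: "s i \<le> h i" if "i < cof \<alpha>" for i
    using h(1) that by (intro s_le) (auto simp: strict_mono_on_def intro: order.strict_trans)
  have mono: "strict_mono_on {..<cof \<alpha>} s"
    using above s_le_h by (intro strict_mono_onI) (auto intro: le_less_trans)
  have h_less: "h i < \<alpha>" if "i < cof \<alpha>" for i
    using A(1) h(2) that unfolding unbounded_in_def by blast
  have cofinal: "\<exists>i<cof \<alpha>. \<beta> \<le> h i" if "\<beta> < \<alpha>" for \<beta>
    using A(1) h(2) that unfolding unbounded_in_def by blast
  have "\<exists>\<gamma>\<in>s ` {..<cof \<alpha>}. \<beta> \<le> \<gamma>" if \<beta>: "\<beta> < \<alpha>" for \<beta>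
  proof -
    obtain i where i: "i < cof \<alpha>" "\<beta> \<le> h i"
      using cofinal \<beta> by blast
    obtain \<gamma> where "\<gamma> < \<alpha>" "h i < \<gamma>"
      using limit_ordinalD[OF assms h_less[OF i(1)]] by blast
    then obtain k where k: "k < cof \<alpha>" "h i < h k"
      using cofinal by (meson less_le_trans)
    then have "i < k"
      using strict_mono_on_less[OF h(1), of i k] i(1) by simp
    then show ?thesis
      using above[OF k(1)] i(2) k(1) by (meson image_eqI lessThan_iff less_imp_le order_trans)
  qed
  moreover have "\<beta> \<in> s ` {..<cof \<alpha>}" if \<beta>: "\<beta> < \<alpha>" "limit_point (s ` {..<cof \<alpha>}) \<beta>" for \<beta>
  proof -
    \<comment> \<open>The limit point \<beta> must be \<open>s i\<close> for the first
      \<open>i\<close> with \<open>\<beta> \<le> h i\<close>: minimality gives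
      \<open>s i \<le> \<beta>\<close>, and a value \<open>s k\<close> strictly between them would
      exceed \<open>h i\<close>.\<close>
    define i where "i = (LEAST i. \<beta> \<le> h i)"
    obtain i' where i': "i' < cof \<alpha>" "\<beta> \<le> h i'"
      using cofinal \<beta>(1) by blast
    have i: "\<beta> \<le> h i" "i < cof \<alpha>"
      using LeastI[of "\<lambda>i. \<beta> \<le> h i", OF i'(2)] Least_le[of "\<lambda>i. \<beta> \<le> h i", OF i'(2)] i'(1)
      unfolding i_def by auto
    have "h j < \<beta>" if "j < i" for j
      using not_less_Least[of j "\<lambda>i. \<beta> \<le> h i"] that unfolding i_def by simp
    then have "s i \<le> \<beta>"
      using s_le by blast
    moreover have False if si: "s i < \<beta>"
    proof -
      obtain k where k: "k < cof \<alpha>" "s i < s k" "s k < \<beta>"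
        using \<beta>(2) si unfolding limit_point_def by blast
      then have "i < k"
        using strict_mono_on_less[OF mono, of i k] i(2) by simp
      then show False
        using above[OF k(1)] i(1) k(3) by (meson less_trans not_le)
    qed
    ultimately show ?thesis
      using i(2) by fastforce
  qed
  moreover have "s ` {..<cof \<alpha>} \<subseteq> {..<\<alpha>}"
    using s_le_h h_less by (auto intro: le_less_trans)
  ultimately show ?thesis
    using mono unfolding club_def unbounded_in_def by blast
qed

lemma club_imp_unbounded: "club \<alpha> C \<Longrightarrow> \<beta> < \<alpha> \<Longrightarrow> \<exists>\<gamma>\<in>C. \<beta> \<le> \<gamma> \<and> \<gamma> < \<alpha>"
  unfolding club_def unbounded_in_def by blast

lemma cofinal_club_initial_lepoll:
  fixes s :: "'a::wellorder \<Rightarrow> 'a"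
  assumes "strict_mono_on {..<\<theta>} s" "club \<alpha> (s ` {..<\<theta>})" "\<beta> < \<alpha>"
  shows "\<exists>i<\<theta>. s ` {..<\<theta>} \<inter> {..<\<beta>} \<lesssim> {..<i}"
proof -
  obtain i where i: "i < \<theta>" "\<beta> \<le> s i"
    using club_imp_unbounded[OF assms(2,3)] by blast
  have "s ` {..<\<theta>} \<inter> {..<\<beta>} \<subseteq> s ` {..<i}"
  proof
    fix x assume "x \<in> s ` {..<\<theta>} \<inter> {..<\<beta>}"
    then obtain k where k: "k < \<theta>" "x = s k" "s k < s i"
      using i(2) by auto
    then have "k < i"
      using strict_mono_on_less[OF assms(1), of k i] i(1) by simp
    with k show "x \<in> s ` {..<i}" by blast
  qed
  then show ?thesis
    using i(1) subset_image_lepoll by blast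
qed

section \<open>Cardinal arithmetic on initial segments\<close>

text \<open>Minimality alone gives this, whether or not a larger cardinality occurs in the
  type.\<close>

lemma card_succ_lepoll: "\<alpha> < card_succ \<mu> \<Longrightarrow> {..<\<alpha>} \<lesssim> {..<\<mu>}"
  unfolding card_succ_def by (intro not_lesspoll_imp_lepoll not_less_Least)

lemma lesspoll_card_succ:
  assumes "{..<\<mu>::'a} \<prec> {..<\<nu>::'a::wellorder}"
  shows "{..<\<mu>} \<prec> {..<card_succ \<mu>}"
  unfolding card_succ_def using assms by (rule LeastI[where P = "\<lambda>\<alpha>. {..<\<mu>} \<prec> {..<\<alpha>}"])

lemma lessThan_eq_insert:
  fixes \<beta> :: "'a::wellorder"
  assumes "\<beta> < \<alpha>" "\<not> (\<exists>\<gamma><\<alpha>. \<beta> < \<gamma>)"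
  shows "{..<\<alpha>} = insert \<beta> {..<\<beta>}"
  using assms by fastforce

lemma insert_lepoll_infinite:
  assumes "infinite K" "A \<lesssim> K"
  shows "insert x A \<lesssim> K"
  using Un_lepoll_infinite[OF assms(1) _ assms(2), of "{x}"] assms(1)
  by (simp add: finite_lepoll_infinite)

text \<open>An infinite successor ordinal is equinumerous with its predecessor.\<close>

lemma infinite_cardinal_limit:
  assumes "is_cardinal \<kappa>" "infinite {..<\<kappa>}"
  shows "limit_ordinal \<kappa>"
  unfolding limit_ordinal_def
proof (intro conjI allI impI)
  show "{..<\<kappa>} \<noteq> {}"
    using assms(2) by auto
next
  fix \<beta> assume \<beta>: "\<beta> < \<kappa>"
  show "\<exists>\<gamma><\<kappa>. \<beta> < \<gamma>"
  proof (rule ccontr)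
    assume "\<not> ?thesis"
    then have eq: "{..<\<kappa>} = insert \<beta> {..<\<beta>}"
      using \<beta> by (rule lessThan_eq_insert[rotated])
    then have "infinite {..<\<beta>}"
      using assms(2) by (metis finite_insert)
    then have "{..<\<kappa>} \<lesssim> {..<\<beta>}"
      unfolding eq by (rule infinite_insert_lepoll)
    moreover have "{..<\<beta>} \<prec> {..<\<kappa>}"
      using assms(1) \<beta> by (simp add: is_cardinal_def)
    ultimately show False
      using lesspoll_trans2 by blast
  qed
qed

lemma card_succ_greater:
  assumes "infinite {..<\<mu>}" "{..<\<mu>} \<prec> {..<card_succ \<mu>}" "\<beta> < card_succ \<mu>"
  shows "\<exists>\<gamma><card_succ \<mu>. \<beta> < \<gamma>"
proof (rule ccontr)
  assume "\<not> ?thesis"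
  then have "{..<card_succ \<mu>} = insert \<beta> {..<\<beta>}"
    using assms(3) by (rule lessThan_eq_insert[rotated])
  then have "{..<card_succ \<mu>} \<lesssim> {..<\<mu>}"
    using insert_lepoll_infinite[OF assms(1) card_succ_lepoll[OF assms(3)]] by simp
  with assms(2) show False
    using lesspoll_trans2 by blast
qed

text \<open>If \<open>A\<close> were unbounded, the successor cardinal would be a union of at most
  \<mu> initial segments, each of size at most \<mu>.\<close>

lemma card_succ_regular:
  assumes "infinite {..<\<mu>}" "{..<\<mu>} \<prec> {..<card_succ \<mu>}"
    and A: "A \<lesssim> {..<\<mu>}" "A \<subseteq> {..<card_succ \<mu>}"
  shows "\<exists>\<beta><card_succ \<mu>. \<forall>a\<in>A. a \<le> \<beta>"
proof (rule ccontr)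
  assume neg: "\<not> ?thesis"
  have "{..<card_succ \<mu>} \<subseteq> (\<Union>a\<in>A. {..<a})"
  proof
    fix \<beta> assume "\<beta> \<in> {..<card_succ \<mu>}"
    then show "\<beta> \<in> (\<Union>a\<in>A. {..<a})"
      using neg by (force simp: not_le)
  qed
  then have "{..<card_succ \<mu>} \<lesssim> (\<Union>a\<in>A. {..<a})"
    by (rule subset_imp_lepoll)
  also have "\<dots> \<lesssim> {..<\<mu>}"
    using A by (intro UN_lepoll_infinite[OF assms(1)] card_succ_lepoll) auto
  finally show False
    using assms(2) lesspoll_trans2 by blast
qed

text \<open>Suppose \<open>\<kappa> \<le> cof \<alpha>\<close> and split \<kappa> into
  \<open>cof \<kappa>\<close> many initial segments. A map of \<kappa> onto \<alpha> has bounded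
  image on each, being of size below \<open>cof \<alpha>\<close>, and the
  \<open>cof \<kappa>\<close> many bounds are again bounded, so the map misses part of
  \<alpha>.\<close>

lemma cof_less_singular:
  assumes "limit_ordinal \<kappa>" "cof \<kappa> < \<kappa>" "{..<\<alpha>} \<lesssim> {..<\<kappa>}"
  shows "cof \<alpha> < \<kappa>"
proof (rule ccontr)
  assume "\<not> cof \<alpha> < \<kappa>"
  then have le: "\<kappa> \<le> cof \<alpha>" by simp
  obtain A where A: "unbounded_in \<kappa> A" "order_type A = cof \<kappa>"
    by (rule cof_attained)
  then have "A \<subseteq> {..<\<kappa>}"
    by (simp add: unbounded_in_def)
  then have A_le: "A \<lesssim> {..<cof \<kappa>}"
    using order_type_eqpoll A(2) by (metis eqpoll_imp_lepoll eqpoll_sym)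
  obtain g where g: "{..<\<alpha>} \<subseteq> g ` {..<\<kappa>}"
    using assms(3) unfolding lepoll_iff by blast
  have "\<exists>\<beta><\<alpha>. \<forall>x\<in>g ` {..<a} \<inter> {..<\<alpha>}. x < \<beta>" if "a \<in> A" for a
  proof (rule bounded_of_lepoll_cof)
    show "g ` {..<a} \<inter> {..<\<alpha>} \<lesssim> {..<a}"
      by (rule subset_image_lepoll) auto
    show "a < cof \<alpha>"
      using that le \<open>A \<subseteq> {..<\<kappa>}\<close> by auto
  qed simp
  then obtain b where b: "\<And>a. a \<in> A \<Longrightarrow> b a < \<alpha>"
      "\<And>a x. a \<in> A \<Longrightarrow> x \<in> g ` {..<a} \<Longrightarrow> x < \<alpha> \<Longrightarrow> x < b a"
    by (metis IntI lessThan_iff)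
  have "b ` A \<lesssim> {..<cof \<kappa>}"
    using image_lepoll A_le by (rule lepoll_trans)
  then obtain \<beta> where \<beta>: "\<beta> < \<alpha>" "\<And>a. a \<in> A \<Longrightarrow> b a < \<beta>"
    using bounded_of_lepoll_cof[of "b ` A" "cof \<kappa>" \<alpha>] b(1) assms(2) le by fastforce
  obtain x where x: "x < \<kappa>" "\<beta> = g x"
    using g \<beta>(1) by blast
  obtain x' where "x' < \<kappa>" "x < x'"
    using limit_ordinalD[OF assms(1) x(1)] by blast
  then obtain a where a: "a \<in> A" "x < a"
    using A(1) unfolding unbounded_in_def by (meson less_le_trans)
  have "\<beta> < b a"
    using b(2)[OF a(1), of \<beta>] a(2) x(2) \<beta>(1) by blast
  with \<beta>(2)[OF a(1)] show False by simp
qed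

lemma lesspoll_initial_segment:
  assumes "Z \<prec> {..<\<kappa>::'a::wellorder}"
  shows "\<exists>\<theta><\<kappa>. Z \<lesssim> {..<\<theta>}"
proof -
  obtain f where f: "inj_on f Z" "f ` Z \<subseteq> {..<\<kappa>}"
    using assms unfolding lesspoll_def lepoll_def by blast
  let ?\<theta> = "order_type (f ` Z)"
  have eq: "Z \<approx> {..<?\<theta>}"
    using order_type_eqpoll[OF f(2)] f(1) by (simp add: eqpoll_sym)
  have "?\<theta> \<le> \<kappa>"
    by (rule order_type_le_strict_mono[OF f(2), of "\<lambda>x. x"]) (use f(2) in \<open>auto simp: strict_mono_on_def\<close>)
  moreover have "?\<theta> \<noteq> \<kappa>"
    using assms eq by (metis lesspoll_def)
  ultimately have "?\<theta> < \<kappa>" by simp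
  with eq show ?thesis
    using eqpoll_imp_lepoll by blast
qed

lemma Pow_lepoll_mono:
  assumes "A \<lesssim> B"
  shows "Pow A \<lesssim> Pow B"
proof -
  obtain g where g: "A \<subseteq> g ` B"
    using assms unfolding lepoll_iff by blast
  have "Pow A \<subseteq> (\<lambda>X. g ` X) ` Pow B"
  proof
    fix Y assume "Y \<in> Pow A"
    then have "Y = g ` {b \<in> B. g b \<in> Y}"
      using g by auto
    then show "Y \<in> (\<lambda>X. g ` X) ` Pow B" by blast
  qed
  then show ?thesis
    by (rule subset_image_lepoll)
qed

text \<open>The strong limit property speaks of cardinals below \<kappa> only, so \<open>Z\<close>
  is replaced by the least ordinal into which it embeds, which is a cardinal.\<close>

lemma strong_limit_Pow_lesspoll:
  fixes \<kappa> :: "'a::wellorder"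
  assumes "strong_limit_cardinal \<kappa>" "Z \<prec> {..<\<kappa>}"
  shows "Pow Z \<prec> {..<\<kappa>}"
proof -
  define \<mu> :: 'a where "\<mu> = (LEAST \<mu>. Z \<lesssim> {..<\<mu>})"
  obtain \<theta> where \<theta>: "\<theta> < \<kappa>" "Z \<lesssim> {..<\<theta>}"
    using lesspoll_initial_segment[OF assms(2)] by blast
  have \<mu>: "Z \<lesssim> {..<\<mu>}" "\<mu> \<le> \<theta>"
    using LeastI[of "\<lambda>\<mu>. Z \<lesssim> {..<\<mu>}", OF \<theta>(2)] Least_le[of "\<lambda>\<mu>. Z \<lesssim> {..<\<mu>}", OF \<theta>(2)]
    unfolding \<mu>_def by auto
  have "is_cardinal \<mu>"
    unfolding is_cardinal_def
  proof (intro allI impI)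
    fix \<beta> assume "\<beta> < \<mu>"
    then have "\<not> Z \<lesssim> {..<\<beta>}"
      unfolding \<mu>_def by (rule not_less_Least)
    then show "{..<\<beta>} \<prec> {..<\<mu>}"
      using not_lesspoll_imp_lepoll \<mu>(1) lepoll_trans by blast
  qed
  moreover have "\<mu> < \<kappa>"
    using \<mu>(2) \<theta>(1) by simp
  ultimately have "Pow {..<\<mu>} \<prec> {..<\<kappa>}"
    using assms(1) by (simp add: strong_limit_cardinal_def)
  then show ?thesis
    using Pow_lepoll_mono[OF \<mu>(1)] by (rule lesspoll_trans1[rotated])
qed

text \<open>Both factors embed in one initial segment below \<kappa>; its square is finite or no
  larger than the segment.\<close>

lemma cardinal_Times_lesspoll:
  fixes \<kappa> :: "'a::wellorder"
  assumes \<kappa>: "is_cardinal \<kappa>" "infinite {..<\<kappa>}" and A: "A \<prec> {..<\<kappa>}" and B: "B \<prec> {..<\<kappa>}"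
  shows "A \<times> B \<prec> {..<\<kappa>}"
proof -
  obtain \<theta>1 \<theta>2 where \<theta>: "\<theta>1 < \<kappa>" "A \<lesssim> {..<\<theta>1}" "\<theta>2 < \<kappa>" "B \<lesssim> {..<\<theta>2}"
    using lesspoll_initial_segment[OF A] lesspoll_initial_segment[OF B] by blast
  define \<theta> where "\<theta> = max \<theta>1 \<theta>2"
  have "\<theta> < \<kappa>"
    using \<theta> by (simp add: \<theta>_def)
  then have lt: "{..<\<theta>} \<prec> {..<\<kappa>}"
    using \<kappa>(1) by (simp add: is_cardinal_def)
  have "A \<lesssim> {..<\<theta>}" "B \<lesssim> {..<\<theta>}"
    using \<theta>(2,4) by (auto simp: \<theta>_def elim!: lepoll_trans intro!: subset_imp_lepoll)
  then have le: "A \<times> B \<lesssim> {..<\<theta>} \<times> {..<\<theta>}"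
    by (rule times_lepoll_mono)
  show ?thesis
  proof (cases "finite {..<\<theta>}")
    case True
    then have "{..<\<theta>} \<times> {..<\<theta>} \<prec> {..<\<kappa>}"
      using \<kappa>(2) by (intro finite_lesspoll_infinite) auto
    with le show ?thesis
      by (rule lesspoll_trans1)
  next
    case False
    show ?thesis
      using lesspoll_trans1[OF lepoll_trans[OF le infinite_times_self_lepoll[OF False]] lt] .
  qed
qed

text \<open>The part of \<open>E\<close> below one of its own elements is enumerated by an ordinal
  below \<delta>, and \<delta> is a cardinal.\<close>

lemma initial_segment_lesspoll:
  fixes \<delta> :: "'a::wellorder"
  assumes "is_cardinal \<delta>" "E \<subseteq> {..<\<xi>}" "order_type E \<le> \<delta>" "e \<in> E" "\<eta> \<le> e"
  shows "E \<inter> {..<\<eta>} \<prec> {..<\<delta>}"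
proof -
  obtain h where h: "enumerates h (order_type E) E"
    using enumerates_order_type[OF assms(2)] .
  have mono: "strict_mono_on {..<order_type E} h" and img: "h ` {..<order_type E} = E"
    using h unfolding enumerates_def bij_betw_def by auto
  obtain i where i: "i < order_type E" "e = h i"
    using img assms(4) by blast
  have "E \<inter> {..<\<eta>} \<subseteq> h ` {..<i}"
  proof
    fix x assume x: "x \<in> E \<inter> {..<\<eta>}"
    then obtain k where k: "k < order_type E" "x = h k"
      using img by blast
    then have "h k < h i"
      using x assms(5) i(2) by auto
    then have "k < i"
      using strict_mono_on_less[OF mono, of k i] k(1) i(1) by simp
    with k show "x \<in> h ` {..<i}" by blast
  qed
  then have "E \<inter> {..<\<eta>} \<lesssim> {..<i}"
    by (rule subset_image_lepoll)
  also have "{..<i} \<prec> {..<\<delta>}"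
    using assms(1,3) i(1) by (simp add: is_cardinal_def)
  finally show ?thesis .
qed

section \<open>Weak square sequences\<close>

lemma weak_square_seqD:
  assumes "weak_square_seq \<mu> \<C>" "\<alpha> < card_succ \<mu>" "limit_ordinal \<alpha>"
  shows "C \<in> \<C> \<alpha> \<Longrightarrow> club \<alpha> C" "C \<in> \<C> \<alpha> \<Longrightarrow> order_type C \<le> \<mu>"
    and "C \<in> \<C> \<alpha> \<Longrightarrow> \<beta> < \<alpha> \<Longrightarrow> limit_point C \<beta> \<Longrightarrow> C \<inter> {..<\<beta>} \<in> \<C> \<beta>"
    and "\<C> \<alpha> \<noteq> {}" "\<C> \<alpha> \<lesssim> {..<\<mu>}"
  using assms unfolding weak_square_seq_def by blast+

lemma limit_point_imp_limit_ordinal: "limit_point C \<beta> \<Longrightarrow> limit_ordinal \<beta>"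
  unfolding limit_point_def limit_ordinal_def by blast

definition seq_traces :: "'a::wellorder \<Rightarrow> ('a \<Rightarrow> 'a set set) \<Rightarrow> 'a \<Rightarrow> 'a set set" where
  "seq_traces \<mu> \<C> \<eta> = {E \<inter> {..<\<eta>} | E \<xi>. \<xi> < card_succ \<mu> \<and> limit_ordinal \<xi> \<and> E \<in> \<C> \<xi>}"

text \<open>Coherence only controls traces at limit points, where the trace is in
  \<open>\<C> \<eta>\<close>. Otherwise \<open>E\<close> has no element strictly between some
  \<gamma> and \<eta>, and the trace is one at \<gamma>, possibly with \<gamma> added; induction on
  \<eta> counts these.\<close>

lemma seq_traces_lepoll:
  fixes \<mu> :: "'a::wellorder"
  assumes sq: "weak_square_seq \<mu> \<C>" and inf: "infinite {..<\<mu>}" and "\<eta> < card_succ \<mu>"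
  shows "seq_traces \<mu> \<C> \<eta> \<lesssim> {..<\<mu>}"
  using assms(3)
proof (induction \<eta> rule: less_induct)
  case (less \<eta>)
  let ?K = "seq_traces \<mu> \<C>"
  let ?L = "if limit_ordinal \<eta> then \<C> \<eta> else {}"
  have "?K \<eta> \<subseteq> insert {} (?L \<union> (\<Union>\<gamma>\<in>{..<\<eta>}. ?K \<gamma> \<union> insert \<gamma> ` ?K \<gamma>))"
  proof
    fix D assume "D \<in> ?K \<eta>"
    then obtain E \<xi> where E: "\<xi> < card_succ \<mu>" "limit_ordinal \<xi>" "E \<in> \<C> \<xi>" "D = E \<inter> {..<\<eta>}"
      unfolding seq_traces_def by blast
    have E_sub: "E \<subseteq> {..<\<xi>}"
      using weak_square_seqD(1)[OF sq E(1-3)] by (simp add: club_def unbounded_in_def)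
    show "D \<in> insert {} (?L \<union> (\<Union>\<gamma>\<in>{..<\<eta>}. ?K \<gamma> \<union> insert \<gamma> ` ?K \<gamma>))"
    proof (cases "limit_point E \<eta>")
      case True
      have "\<not> \<xi> < \<eta>"
        using True E_sub unfolding limit_point_def by (meson less_asym lessThan_iff subsetD)
      then have "\<eta> < \<xi> \<or> \<eta> = \<xi>" by auto
      then have "D \<in> \<C> \<eta>"
      proof
        assume "\<eta> < \<xi>"
        then show ?thesis
          using weak_square_seqD(3)[OF sq E(1-3) _ True] E(4) by simp
      next
        assume "\<eta> = \<xi>"
        moreover have "D = E" if "\<eta> = \<xi>"
          using E(4) E_sub that by blast
        ultimately show ?thesis
          using E(3) by simp
      qed
      then show ?thesis
        using limit_point_imp_limit_ordinal[OF True] by simp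
    next
      case False
      show ?thesis
      proof (cases "{..<\<eta>} = {}")
        case True
        then show ?thesis using E(4) by simp
      next
        case nonempty: False
        then obtain \<gamma> where \<gamma>: "\<gamma> < \<eta>" "\<forall>x\<in>E. \<gamma> < x \<longrightarrow> \<not> x < \<eta>"
          using False unfolding limit_point_def by blast
        have K: "E \<inter> {..<\<gamma>} \<in> ?K \<gamma>"
          unfolding seq_traces_def using E by blast
        have "x < \<gamma> \<or> x = \<gamma>" if "x \<in> D" for x
          using \<gamma> E(4) that by (meson IntE lessThan_iff linorder_less_linear)
        then have "D = E \<inter> {..<\<gamma>} \<or> D = insert \<gamma> (E \<inter> {..<\<gamma>})"
          using E(4) \<gamma>(1) by (cases "\<gamma> \<in> E") auto
        then show ?thesis
          using K \<gamma>(1) by blast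
      qed
    qed
  qed
  then have "?K \<eta> \<lesssim> insert {} (?L \<union> (\<Union>\<gamma>\<in>{..<\<eta>}. ?K \<gamma> \<union> insert \<gamma> ` ?K \<gamma>))"
    by (rule subset_imp_lepoll)
  also have "\<dots> \<lesssim> {..<\<mu>}"
  proof (intro insert_lepoll_infinite[OF inf] Un_lepoll_infinite[OF inf] UN_lepoll_infinite[OF inf])
    show "?L \<lesssim> {..<\<mu>}"
      using weak_square_seqD(5)[OF sq less.prems] by simp
    show "{..<\<eta>} \<lesssim> {..<\<mu>}"
      using less.prems by (rule card_succ_lepoll)
    fix \<gamma> assume "\<gamma> \<in> {..<\<eta>}"
    then show K: "?K \<gamma> \<lesssim> {..<\<mu>}"
      using less by simp
    show "insert \<gamma> ` ?K \<gamma> \<lesssim> {..<\<mu>}"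
      using image_lepoll K by (rule lepoll_trans)
  qed
  finally show ?case .
qed

text \<open>Coherence only has to hold up to covering by few small sets, since a small set has few subsets
  below a strong limit cardinal.\<close>

lemma weak_square_of_covering:
  fixes \<kappa> :: "'a::wellorder" and F :: "'a \<Rightarrow> 'a set set" and C :: "'a \<Rightarrow> 'a set"
  assumes \<kappa>: "strong_limit_cardinal \<kappa>"
    and F_card: "\<And>\<beta>. \<beta> < card_succ \<kappa> \<Longrightarrow> F \<beta> \<lesssim> {..<\<kappa>}"
    and F_small: "\<And>\<beta> Z. \<beta> < card_succ \<kappa> \<Longrightarrow> Z \<in> F \<beta> \<Longrightarrow> Z \<prec> {..<\<kappa>}"
    and club: "\<And>\<alpha>. \<alpha> < card_succ \<kappa> \<Longrightarrow> limit_ordinal \<alpha> \<Longrightarrow> club \<alpha> (C \<alpha>)"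
    and small: "\<And>\<alpha>. \<alpha> < card_succ \<kappa> \<Longrightarrow> limit_ordinal \<alpha> \<Longrightarrow> C \<alpha> \<prec> {..<\<kappa>}"
    and cover: "\<And>\<alpha> \<beta>. \<alpha> < card_succ \<kappa> \<Longrightarrow> limit_ordinal \<alpha> \<Longrightarrow> \<beta> \<le> \<alpha> \<Longrightarrow> limit_point (C \<alpha>) \<beta>
      \<Longrightarrow> \<exists>Z\<in>F \<beta>. C \<alpha> \<inter> {..<\<beta>} \<subseteq> Z"
  shows "weak_square \<kappa>"
proof -
  have card: "is_cardinal \<kappa>" and inf: "infinite {..<\<kappa>}"
    using \<kappa> by (simp_all add: strong_limit_cardinal_def)
  \<comment> \<open>All small clubs with covered traces are taken, so coherence is inherited by
    restriction. The case \<xi> = \<beta> covers the club itself, so it is a subset of a member of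
    \<open>F \<beta>\<close>, which bounds their number.\<close>
  define \<C> where "\<C> \<beta> = {X. club \<beta> X \<and> X \<prec> {..<\<kappa>} \<and>
    (\<forall>\<xi>\<le>\<beta>. limit_point X \<xi> \<longrightarrow> (\<exists>Z\<in>F \<xi>. X \<inter> {..<\<xi>} \<subseteq> Z))}" for \<beta>
  have "weak_square_seq \<kappa> \<C>"
    unfolding weak_square_seq_def
  proof (intro allI impI conjI ballI)
    fix \<alpha> X assume \<alpha>: "\<alpha> < card_succ \<kappa>" "limit_ordinal \<alpha>" and X: "X \<in> \<C> \<alpha>"
    show "club \<alpha> X"
      using X by (simp add: \<C>_def)
    then have sub: "X \<subseteq> {..<\<alpha>}"
      by (simp add: club_def unbounded_in_def)
    show "order_type X \<le> \<kappa>"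
      using order_type_less_cardinal[OF card sub] X by (simp add: \<C>_def)
    fix \<beta> assume \<beta>: "\<beta> < \<alpha>" "limit_point X \<beta>"
    have lp: "limit_point X \<xi>" if "limit_point (X \<inter> {..<\<beta>}) \<xi>" for \<xi>
      using that unfolding limit_point_def by blast
    have "unbounded_in \<beta> (X \<inter> {..<\<beta>})"
      using \<beta>(2) unfolding limit_point_def unbounded_in_def by (auto intro: less_imp_le)
    moreover have "\<xi> \<in> X \<inter> {..<\<beta>}" if "\<xi> < \<beta>" "limit_point (X \<inter> {..<\<beta>}) \<xi>" for \<xi>
      using \<open>club \<alpha> X\<close> lp[OF that(2)] that(1) \<beta>(1) unfolding club_def by simp
    ultimately have "club \<beta> (X \<inter> {..<\<beta>})"
      by (simp add: club_def)
    moreover have "X \<inter> {..<\<beta>} \<prec> {..<\<kappa>}"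
      using X by (auto simp: \<C>_def intro: lesspoll_trans1 subset_imp_lepoll)
    moreover have "\<exists>Z\<in>F \<xi>. X \<inter> {..<\<beta>} \<inter> {..<\<xi>} \<subseteq> Z"
      if \<xi>: "\<xi> \<le> \<beta>" "limit_point (X \<inter> {..<\<beta>}) \<xi>" for \<xi>
    proof -
      have "\<xi> \<le> \<alpha>"
        using \<xi>(1) \<beta>(1) by simp
      then obtain Z where "Z \<in> F \<xi>" "X \<inter> {..<\<xi>} \<subseteq> Z"
        using X lp[OF \<xi>(2)] unfolding \<C>_def by blast
      then show ?thesis by blast
    qed
    ultimately show "X \<inter> {..<\<beta>} \<in> \<C> \<beta>"
      unfolding \<C>_def by blast
  next
    fix \<alpha> assume \<alpha>: "\<alpha> < card_succ \<kappa>" "limit_ordinal \<alpha>"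
    have "C \<alpha> \<in> \<C> \<alpha>"
      unfolding \<C>_def using club[OF \<alpha>] small[OF \<alpha>] cover[OF \<alpha>] by blast
    then show "\<C> \<alpha> \<noteq> {}" by blast
    have "\<C> \<alpha> \<subseteq> (\<Union>Z\<in>F \<alpha>. Pow Z)"
    proof
      fix X assume X: "X \<in> \<C> \<alpha>"
      then have unb: "unbounded_in \<alpha> X"
        by (simp add: \<C>_def club_def)
      have "\<exists>\<xi>\<in>X. \<gamma> < \<xi> \<and> \<xi> < \<alpha>" if \<gamma>: "\<gamma> < \<alpha>" for \<gamma>
      proof -
        obtain \<gamma>' where "\<gamma>' < \<alpha>" "\<gamma> < \<gamma>'"
          using limit_ordinalD[OF \<alpha>(2) \<gamma>] by blast
        then show ?thesis
          using unb unfolding unbounded_in_def by (meson less_le_trans lessThan_iff subsetD)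
      qed
      then have "limit_point X \<alpha>"
        using \<alpha>(2) by (simp add: limit_point_def limit_ordinal_def)
      then obtain Z where "Z \<in> F \<alpha>" "X \<inter> {..<\<alpha>} \<subseteq> Z"
        using X unfolding \<C>_def by blast
      moreover have "X \<inter> {..<\<alpha>} = X"
        using unb unfolding unbounded_in_def by blast
      ultimately show "X \<in> (\<Union>Z\<in>F \<alpha>. Pow Z)" by auto
    qed
    then have "\<C> \<alpha> \<lesssim> (\<Union>Z\<in>F \<alpha>. Pow Z)"
      by (rule subset_imp_lepoll)
    also have "\<dots> \<lesssim> {..<\<kappa>}"
      using F_card[OF \<alpha>(1)] strong_limit_Pow_lesspoll[OF \<kappa> F_small[OF \<alpha>(1)]]
      by (intro UN_lepoll_infinite[OF inf]) (auto intro: lesspoll_imp_lepoll)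
    finally show "\<C> \<alpha> \<lesssim> {..<\<kappa>}" .
  qed
  then show ?thesis
    unfolding weak_square_def by blast
qed

section \<open>Good points\<close>

text \<open>The threshold need not belong to \<open>T\<close>. On a \<open>T\<close> bounded below
  \<kappa> this is vacuous, so extracting an index needs \<open>cofinal_subset\<close>.\<close>

definition almost_all :: "'a::wellorder \<Rightarrow> 'a set \<Rightarrow> ('a \<Rightarrow> bool) \<Rightarrow> bool" where
  "almost_all \<kappa> T P \<longleftrightarrow> (\<exists>j<\<kappa>. \<forall>\<delta>\<in>T. j \<le> \<delta> \<longrightarrow> P \<delta>)"

lemma almost_all_mono2:
  assumes "almost_all \<kappa> T P" "almost_all \<kappa> T Q" "T' \<subseteq> T"
    and "\<And>\<delta>. \<delta> \<in> T' \<Longrightarrow> P \<delta> \<Longrightarrow> Q \<delta> \<Longrightarrow> R \<delta>"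
  shows "almost_all \<kappa> T' R"
proof -
  obtain j1 j2 where "j1 < \<kappa>" "j2 < \<kappa>" "\<forall>\<delta>\<in>T. j1 \<le> \<delta> \<longrightarrow> P \<delta>" "\<forall>\<delta>\<in>T. j2 \<le> \<delta> \<longrightarrow> Q \<delta>"
    using assms(1,2) unfolding almost_all_def by blast
  then have "max j1 j2 < \<kappa> \<and> (\<forall>\<delta>\<in>T'. max j1 j2 \<le> \<delta> \<longrightarrow> R \<delta>)"
    using assms(3,4) by auto
  then show ?thesis
    unfolding almost_all_def by blast
qed

section \<open>Interleaved points and the sets that code them\<close>

definition interleaved :: "'a::wellorder \<Rightarrow> 'a set \<Rightarrow> ('a \<Rightarrow> 'a \<Rightarrow> 'a) \<Rightarrow> ('a \<Rightarrow> 'a set) \<Rightarrow> 'a set" where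
  "interleaved \<kappa> T f D =
    {\<xi>. \<forall>\<eta><\<xi>. \<exists>\<zeta><\<xi>. almost_all \<kappa> T (\<lambda>\<delta>. \<exists>e\<in>D \<delta>. f \<eta> \<delta> \<le> e \<and> e < f \<zeta> \<delta>)}"

definition increasing_mod_bounded :: "'a::wellorder \<Rightarrow> 'a set \<Rightarrow> ('a \<Rightarrow> 'a \<Rightarrow> 'a) \<Rightarrow> bool" where
  "increasing_mod_bounded \<kappa> T f \<longleftrightarrow>
    (\<forall>\<alpha><card_succ \<kappa>. \<forall>\<beta><\<alpha>. almost_all \<kappa> T (\<lambda>\<delta>. f \<beta> \<delta> < f \<alpha> \<delta>))"

definition cofinal_subset :: "'a::wellorder \<Rightarrow> 'a set \<Rightarrow> bool" where
  "cofinal_subset \<kappa> T \<longleftrightarrow> (\<forall>\<gamma><\<kappa>. \<exists>\<delta>\<in>T. \<gamma> \<le> \<delta>)"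

lemma almost_all_cofinal:
  assumes "almost_all \<kappa> T P" "cofinal_subset \<kappa> T"
  shows "\<exists>\<delta>\<in>T. P \<delta>"
proof -
  obtain j where j: "j < \<kappa>" "\<forall>\<delta>\<in>T. j \<le> \<delta> \<longrightarrow> P \<delta>"
    using assms(1) unfolding almost_all_def by blast
  then obtain \<delta> where "\<delta> \<in> T" "j \<le> \<delta>"
    using assms(2) unfolding cofinal_subset_def by blast
  with j(2) show ?thesis by blast
qed

text \<open>An interleaved \<open>\<xi>\<close> is determined by the sets \<open>D \<delta> \<inter> f \<xi> \<delta>\<close>, for \<open>\<delta> \<in> T\<close>.\<close>

lemma interleaved_lesspoll:
  fixes \<kappa> :: "'a::wellorder"
  assumes \<kappa>: "strong_limit_cardinal \<kappa>" and T: "cofinal_subset \<kappa> T"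
    and incr: "increasing_mod_bounded \<kappa> T f" and small: "Sigma T D \<prec> {..<\<kappa>}"
    and \<beta>: "\<beta> < card_succ \<kappa>"
  shows "interleaved \<kappa> T f D \<inter> {..<\<beta>} \<prec> {..<\<kappa>}"
proof -
  \<comment> \<open>One subset of \<open>Sigma T D\<close> records where \<open>f \<xi>\<close> cuts
    every \<open>D \<delta>\<close>. For two interleaved points, the code of the larger one contains
    some \<open>(\<delta>, e)\<close> that the smaller one omits.\<close>
  define code where "code \<xi> = {(\<delta>, e) \<in> Sigma T D. e < f \<xi> \<delta>}" for \<xi>
  have neq: "code \<xi> \<noteq> code \<xi>'" if \<xi>: "\<xi> < \<xi>'" "\<xi>' < card_succ \<kappa>" "\<xi>' \<in> interleaved \<kappa> T f D" for \<xi> \<xi>'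
  proof -
    obtain \<zeta> where \<zeta>: "\<zeta> < \<xi>'" "almost_all \<kappa> T (\<lambda>\<delta>. \<exists>e\<in>D \<delta>. f \<xi> \<delta> \<le> e \<and> e < f \<zeta> \<delta>)"
      using \<xi> unfolding interleaved_def by blast
    have "almost_all \<kappa> T (\<lambda>\<delta>. f \<zeta> \<delta> < f \<xi>' \<delta>)"
      using incr \<zeta>(1) \<xi>(2) unfolding increasing_mod_bounded_def by blast
    with \<zeta>(2) have "almost_all \<kappa> T (\<lambda>\<delta>. \<exists>e\<in>D \<delta>. f \<xi> \<delta> \<le> e \<and> e < f \<xi>' \<delta>)"
      by (rule almost_all_mono2) (auto intro: order.strict_trans)
    then obtain \<delta> e where "\<delta> \<in> T" "e \<in> D \<delta>" "f \<xi> \<delta> \<le> e" "e < f \<xi>' \<delta>"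
      using almost_all_cofinal T by blast
    then have "(\<delta>, e) \<in> code \<xi>'" "(\<delta>, e) \<notin> code \<xi>"
      by (auto simp: code_def)
    then show ?thesis by blast
  qed
  have "inj_on code (interleaved \<kappa> T f D \<inter> {..<\<beta>})"
  proof (rule linorder_inj_onI')
    fix \<xi> \<xi>' assume "\<xi> \<in> interleaved \<kappa> T f D \<inter> {..<\<beta>}" "\<xi>' \<in> interleaved \<kappa> T f D \<inter> {..<\<beta>}" "\<xi> < \<xi>'"
    then show "code \<xi> \<noteq> code \<xi>'"
      using neq[of \<xi> \<xi>'] \<beta> by (meson IntE lessThan_iff order.strict_trans)
  qed
  moreover have "code ` (interleaved \<kappa> T f D \<inter> {..<\<beta>}) \<subseteq> Pow (Sigma T D)"
    unfolding code_def by blast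
  ultimately have "interleaved \<kappa> T f D \<inter> {..<\<beta>} \<lesssim> Pow (Sigma T D)"
    unfolding lepoll_def by blast
  also have "\<dots> \<prec> {..<\<kappa>}"
    using \<kappa> small by (rule strong_limit_Pow_lesspoll)
  finally show ?thesis .
qed

text \<open>For \<xi> < \<beta>, the interleaving points lie below \<open>f \<zeta> \<delta>\<close>
  with \<zeta> < \<beta>, hence below \<open>f \<beta> \<delta>\<close> for almost all \<delta>, so
  cutting \<open>E \<delta>\<close> there loses none that matter.\<close>

lemma interleaved_restrict:
  assumes incr: "increasing_mod_bounded \<kappa> S f" and "T \<subseteq> S" "\<beta> < card_succ \<kappa>"
    and D: "\<And>\<delta>. \<delta> \<in> T \<Longrightarrow> D \<delta> = E \<delta> \<inter> {..<f \<beta> \<delta>}"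
  shows "interleaved \<kappa> S f E \<inter> {..<\<beta>} \<subseteq> interleaved \<kappa> T f D"
proof
  fix \<xi> assume \<xi>: "\<xi> \<in> interleaved \<kappa> S f E \<inter> {..<\<beta>}"
  have "\<exists>\<zeta><\<xi>. almost_all \<kappa> T (\<lambda>\<delta>. \<exists>e\<in>D \<delta>. f \<eta> \<delta> \<le> e \<and> e < f \<zeta> \<delta>)" if \<eta>: "\<eta> < \<xi>" for \<eta>
  proof -
    obtain \<zeta> where \<zeta>: "\<zeta> < \<xi>" "almost_all \<kappa> S (\<lambda>\<delta>. \<exists>e\<in>E \<delta>. f \<eta> \<delta> \<le> e \<and> e < f \<zeta> \<delta>)"
      using \<xi> \<eta> unfolding interleaved_def by blast
    have "\<zeta> < \<beta>"
      using \<zeta>(1) \<xi> by auto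
    then have "almost_all \<kappa> S (\<lambda>\<delta>. f \<zeta> \<delta> < f \<beta> \<delta>)"
      using incr assms(3) unfolding increasing_mod_bounded_def by blast
    with \<zeta>(2) have "almost_all \<kappa> T (\<lambda>\<delta>. \<exists>e\<in>D \<delta>. f \<eta> \<delta> \<le> e \<and> e < f \<zeta> \<delta>)"
      using \<open>T \<subseteq> S\<close> by (rule almost_all_mono2) (auto simp: D intro: order.strict_trans)
    with \<zeta>(1) show ?thesis by blast
  qed
  then show "\<xi> \<in> interleaved \<kappa> T f D"
    by (simp add: interleaved_def)
qed

lemma interleaved_cong:
  assumes "T = T'" "\<And>\<delta>. \<delta> \<in> T' \<Longrightarrow> D \<delta> = D' \<delta>"
  shows "interleaved \<kappa> T f D = interleaved \<kappa> T' f D'"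
  using assms unfolding interleaved_def almost_all_def by (simp cong: ball_cong)

text \<open>\<open>k \<delta>\<close> lists candidate traces and \<open>q\<close> selects one for
  each \<delta>. The bound \<rho> on indices keeps the family of size at most \<kappa>; the bound on
  cardinalities keeps each member smaller than \<kappa>.\<close>

definition coded_traces ::
    "'a::wellorder \<Rightarrow> 'a set \<Rightarrow> ('a \<Rightarrow> 'a \<Rightarrow> 'a) \<Rightarrow> ('a \<Rightarrow> 'a \<Rightarrow> 'a set) \<Rightarrow> 'a \<Rightarrow> 'a set set" where
  "coded_traces \<kappa> S f k \<beta> = {interleaved \<kappa> T f (\<lambda>\<delta>. k \<delta> (q \<delta>)) \<inter> {..<\<beta>} | T q \<rho>.
     T \<subseteq> S \<and> cofinal_subset \<kappa> T \<and> \<rho> < \<kappa> \<and> (\<forall>\<delta>\<in>T. q \<delta> \<le> \<rho> \<and> k \<delta> (q \<delta>) \<lesssim> {..<\<rho>})}"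

lemma coded_traces_lepoll:
  fixes \<kappa> :: "'a::wellorder"
  assumes \<kappa>: "strong_limit_cardinal \<kappa>" and S: "S \<prec> {..<\<kappa>}"
  shows "coded_traces \<kappa> S f k \<beta> \<lesssim> {..<\<kappa>}"
proof -
  have card: "is_cardinal \<kappa>" and inf: "infinite {..<\<kappa>}"
    using \<kappa> by (simp_all add: strong_limit_cardinal_def)
  \<comment> \<open>A pair \<open>T\<close>, \<open>q\<close> is coded by the graph of
    \<open>q\<close> on \<open>T\<close>, a subset of \<open>S \<times> {..\<rho>}\<close>: the
    domain returns \<open>T\<close>, and the description returns the values of
    \<open>q\<close>.\<close>
  define dec where "dec R = interleaved \<kappa> (Domain R) f (\<lambda>\<delta>. k \<delta> (THE i. (\<delta>, i) \<in> R)) \<inter> {..<\<beta>}" for R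
  have "coded_traces \<kappa> S f k \<beta> \<subseteq> (\<Union>\<rho>\<in>{..<\<kappa>}. dec ` Pow (S \<times> {..\<rho>}))"
  proof
    fix Z assume "Z \<in> coded_traces \<kappa> S f k \<beta>"
    then obtain T q \<rho> where *: "T \<subseteq> S" "\<rho> < \<kappa>" "\<forall>\<delta>\<in>T. q \<delta> \<le> \<rho>"
        "Z = interleaved \<kappa> T f (\<lambda>\<delta>. k \<delta> (q \<delta>)) \<inter> {..<\<beta>}"
      unfolding coded_traces_def by blast
    let ?R = "(\<lambda>\<delta>. (\<delta>, q \<delta>)) ` T"
    have "Z = dec ?R"
      unfolding dec_def *(4)
      by (intro arg_cong2[where f = "(\<inter>)"] interleaved_cong refl)
        (auto intro!: arg_cong2[where f = k] the_equality[symmetric])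
    moreover have "?R \<in> Pow (S \<times> {..\<rho>})"
      using * by auto
    ultimately show "Z \<in> (\<Union>\<rho>\<in>{..<\<kappa>}. dec ` Pow (S \<times> {..\<rho>}))"
      using *(2) by blast
  qed
  then have "coded_traces \<kappa> S f k \<beta> \<lesssim> (\<Union>\<rho>\<in>{..<\<kappa>}. dec ` Pow (S \<times> {..\<rho>}))"
    by (rule subset_imp_lepoll)
  also have "\<dots> \<lesssim> {..<\<kappa>}"
  proof (rule UN_lepoll_infinite[OF inf lepoll_refl])
    fix \<rho> assume "\<rho> \<in> {..<\<kappa>}"
    then obtain \<rho>' where \<rho>': "\<rho>' < \<kappa>" "\<rho> < \<rho>'"
      using limit_ordinalD[OF infinite_cardinal_limit[OF card inf]] by blast
    have "{..\<rho>} \<lesssim> {..<\<rho>'}"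
      using \<rho>'(2) by (intro subset_imp_lepoll) auto
    also have "{..<\<rho>'} \<prec> {..<\<kappa>}"
      using card \<rho>'(1) by (simp add: is_cardinal_def)
    finally have "Pow (S \<times> {..\<rho>}) \<prec> {..<\<kappa>}"
      using strong_limit_Pow_lesspoll[OF \<kappa>] cardinal_Times_lesspoll[OF card inf S] by blast
    then show "dec ` Pow (S \<times> {..\<rho>}) \<lesssim> {..<\<kappa>}"
      using image_lepoll lesspoll_imp_lepoll lepoll_trans by blast
  qed
  finally show ?thesis .
qed

text \<open>The common size bound \<rho> embeds the disjoint union of the selected traces in
  \<open>S \<times> {..<\<rho>}\<close>.\<close>

lemma coded_traces_lesspoll:
  fixes \<kappa> :: "'a::wellorder"
  assumes \<kappa>: "strong_limit_cardinal \<kappa>" and S: "S \<prec> {..<\<kappa>}"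
    and incr: "increasing_mod_bounded \<kappa> S f"
    and \<beta>: "\<beta> < card_succ \<kappa>" and Z: "Z \<in> coded_traces \<kappa> S f k \<beta>"
  shows "Z \<prec> {..<\<kappa>}"
proof -
  have card: "is_cardinal \<kappa>" and inf: "infinite {..<\<kappa>}"
    using \<kappa> by (simp_all add: strong_limit_cardinal_def)
  obtain T q \<rho> where T: "T \<subseteq> S" "cofinal_subset \<kappa> T" and \<rho>: "\<rho> < \<kappa>" "\<forall>\<delta>\<in>T. k \<delta> (q \<delta>) \<lesssim> {..<\<rho>}"
    and Z_eq: "Z = interleaved \<kappa> T f (\<lambda>\<delta>. k \<delta> (q \<delta>)) \<inter> {..<\<beta>}"
    using Z unfolding coded_traces_def by blast
  have "Sigma T (\<lambda>\<delta>. k \<delta> (q \<delta>)) \<lesssim> S \<times> {..<\<rho>}"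
    using T(1) \<rho>(2) by (intro Sigma_lepoll_mono) auto
  also have "\<dots> \<prec> {..<\<kappa>}"
    using card \<rho>(1) by (intro cardinal_Times_lesspoll[OF card inf S]) (simp add: is_cardinal_def)
  finally have "Sigma T (\<lambda>\<delta>. k \<delta> (q \<delta>)) \<prec> {..<\<kappa>}" .
  moreover have "increasing_mod_bounded \<kappa> T f"
    using incr T(1) unfolding increasing_mod_bounded_def almost_all_def by blast
  ultimately show ?thesis
    unfolding Z_eq using interleaved_lesspoll[OF \<kappa> T(2) _ _ \<beta>] by blast
qed

text \<open>This gives one coordinate of the exact upper bound, with \<open>f\<close> as the
  coordinate at \<delta>. At most \<delta> many values are bounded below the successor of \<delta>,
  and their supremum is a limit not attained because \<open>A\<close> has no last element.\<close>

lemma good_point_supremum: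
  fixes \<alpha> \<delta> :: "'a::wellorder" and f :: "'a \<Rightarrow> 'a"
  assumes \<alpha>: "limit_ordinal \<alpha>" and A: "unbounded_in \<alpha> A" "A \<lesssim> {..<\<delta>}"
    and mono: "strict_mono_on A f" and f: "f ` A \<subseteq> {..<card_succ \<delta>}"
    and \<delta>: "infinite {..<\<delta>}" "{..<\<delta>} \<prec> {..<card_succ \<delta>}"
  shows "\<exists>g<card_succ \<delta>. limit_ordinal g \<and> (\<forall>a\<in>A. f a < g) \<and> (\<forall>\<eta><g. \<exists>a\<in>A. \<eta> < f a)"
proof -
  have greater: "\<exists>b\<in>A. a < b" if "a \<in> A" for a
  proof -
    have "a < \<alpha>"
      using A(1) that unfolding unbounded_in_def by blast
    then obtain \<gamma> where "\<gamma> < \<alpha>" "a < \<gamma>"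
      using limit_ordinalD[OF \<alpha>] by blast
    then show ?thesis
      using A(1) unfolding unbounded_in_def by (meson less_le_trans)
  qed
  have f_greater: "\<exists>b\<in>A. f a < f b" if "a \<in> A" for a
    using greater[OF that] mono that by (meson strict_mono_onD)
  have "f ` A \<lesssim> {..<\<delta>}"
    using image_lepoll A(2) by (rule lepoll_trans)
  then obtain \<beta> where \<beta>: "\<beta> < card_succ \<delta>" "\<forall>a\<in>A. f a \<le> \<beta>"
    using card_succ_regular[OF \<delta> _ f] by blast
  define g where "g = (LEAST g. \<forall>a\<in>A. f a < g)"
  have "\<forall>a\<in>A. f a < \<beta>"
    using f_greater \<beta>(2) by (meson less_le_trans)
  then have g: "\<forall>a\<in>A. f a < g" "g \<le> \<beta>"
    using LeastI[of "\<lambda>g. \<forall>a\<in>A. f a < g" \<beta>] Least_le[of "\<lambda>g. \<forall>a\<in>A. f a < g" \<beta>]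
    unfolding g_def by auto
  have cofinal: "\<exists>a\<in>A. \<eta> < f a" if \<eta>: "\<eta> < g" for \<eta>
  proof -
    have "\<not> (\<forall>a\<in>A. f a < \<eta>)"
      using not_less_Least[of \<eta> "\<lambda>g. \<forall>a\<in>A. f a < g"] \<eta> unfolding g_def by blast
    then obtain a where "a \<in> A" "\<eta> \<le> f a"
      by (auto simp: not_less)
    then show ?thesis
      using f_greater by (meson le_less_trans)
  qed
  obtain a where "a \<in> A"
    using \<alpha> A(1) unfolding limit_ordinal_def unbounded_in_def by blast
  then have "limit_ordinal g"
    unfolding limit_ordinal_def using g(1) cofinal by blast
  moreover have "g < card_succ \<delta>"
    using g(2) \<beta>(1) by simp
  ultimately show ?thesis
    using g(1) cofinal by blast
qed

text \<open>The club consists of the points of \<open>C0\<close> at which the scale is interleaved with clubs \<open>E \<delta>\<close>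
  of the least upper bounds \<open>g \<delta>\<close>. Below \<open>\<alpha>\<close>, the traces of \<open>E \<delta>\<close> have both index and
  cardinality below \<open>\<delta>\<close>, so that pressing down gives a bound on an unbounded set of \<open>\<delta>\<close>.\<close>

lemma good_point_club:
  fixes \<kappa> \<alpha> :: "'a::wellorder" and f k :: "'a \<Rightarrow> 'a \<Rightarrow> _"
  assumes card: "is_cardinal \<kappa>" and cc_\<kappa>: "uncountable_cof \<kappa>"
    and S: "stationary \<kappa> S" and H: "club \<kappa> H" and S': "S' = S \<inter> H" and S'_card: "S' \<lesssim> {..<cof \<kappa>}"
    and prod: "\<And>\<beta> \<delta>. \<beta> < card_succ \<kappa> \<Longrightarrow> \<delta> \<in> S' \<Longrightarrow> f \<beta> \<delta> < card_succ \<delta>"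
    and incr: "increasing_mod_bounded \<kappa> S' f"
    and sq: "\<And>\<delta>. \<delta> \<in> S' \<Longrightarrow> is_cardinal \<delta> \<and> weak_square_seq \<delta> (\<C> \<delta>)"
    and k: "\<And>\<beta> \<delta>. \<beta> < card_succ \<kappa> \<Longrightarrow> \<delta> \<in> S' \<Longrightarrow> infinite {..<\<delta>} \<Longrightarrow>
      seq_traces \<delta> (\<C> \<delta>) (f \<beta> \<delta>) \<subseteq> k \<beta> \<delta> ` {..<\<delta>}"
    and \<alpha>: "\<alpha> < card_succ \<kappa>" "limit_ordinal \<alpha>" "cof \<kappa> < cof \<alpha>" "cof \<alpha> < \<kappa>"
    and cc_\<alpha>: "uncountable_cof \<alpha>" and inf_cof: "infinite {..<cof \<alpha>}"
    and C0: "club \<alpha> C0"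
    and good: "unbounded_in \<alpha> A" "order_type A = cof \<alpha>"
      "almost_all \<kappa> S' (\<lambda>\<delta>. strict_mono_on A (\<lambda>\<beta>. f \<beta> \<delta>))"
  shows "\<exists>C\<subseteq>C0. club \<alpha> C \<and> (\<forall>\<beta><\<alpha>. \<exists>Z\<in>coded_traces \<kappa> S' f (k \<beta>) \<beta>. C \<inter> {..<\<beta>} \<subseteq> Z)"
proof -
  have A_sub: "A \<subseteq> {..<\<alpha>}"
    using good(1) by (simp add: unbounded_in_def)
  have A_greater: "\<exists>a\<in>A. \<xi> < a" if \<xi>: "\<xi> < \<alpha>" for \<xi>
  proof -
    obtain \<gamma> where "\<gamma> < \<alpha>" "\<xi> < \<gamma>"
      using limit_ordinalD[OF \<alpha>(2) \<xi>] by blast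
    then show ?thesis
      using good(1) unfolding unbounded_in_def by (meson less_le_trans)
  qed
  obtain j0 where j0: "j0 < \<kappa>" "\<forall>\<delta>\<in>S'. j0 \<le> \<delta> \<longrightarrow> strict_mono_on A (\<lambda>\<beta>. f \<beta> \<delta>)"
    using good(3) unfolding almost_all_def by blast
  \<comment> \<open>Above \<open>cof \<alpha>\<close>, a coordinate \<delta> is infinite and
    \<open>A\<close> has size at most \<delta>, as the supremum requires.\<close>
  define j1 where "j1 = max j0 (cof \<alpha>)"
  have j1: "j1 < \<kappa>"
    using j0(1) \<alpha>(4) by (simp add: j1_def)
  have inf: "infinite {..<\<delta>}" if "j1 \<le> \<delta>" for \<delta>
    using inf_cof that unfolding j1_def by (meson finite_subset lessThan_subset_iff max.boundedE)
  have S'_less: "\<delta> < \<kappa>" if "\<delta> \<in> S'" for \<delta>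
    using S that unfolding S' stationary_def by blast
  have succ: "{..<\<delta>} \<prec> {..<card_succ \<delta>}" if "\<delta> \<in> S'" for \<delta>
    using lesspoll_card_succ[of \<delta> \<kappa>] card S'_less[OF that] by (simp add: is_cardinal_def)
  have mono: "strict_mono_on A (\<lambda>\<beta>. f \<beta> \<delta>)" if "\<delta> \<in> S'" "j1 \<le> \<delta>" for \<delta>
    using j0(2) that by (simp add: j1_def)
  have "\<exists>g<card_succ \<delta>. limit_ordinal g \<and> (\<forall>a\<in>A. f a \<delta> < g) \<and> (\<forall>\<eta><g. \<exists>a\<in>A. \<eta> < f a \<delta>)"
    if \<delta>: "\<delta> \<in> S'" "j1 \<le> \<delta>" for \<delta>
  proof (rule good_point_supremum[OF \<alpha>(2) good(1) _ mono[OF \<delta>] _ inf[OF \<delta>(2)] succ[OF \<delta>(1)]])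
    have "A \<lesssim> {..<cof \<alpha>}"
      using order_type_eqpoll[OF A_sub] good(2) by (simp add: eqpoll_imp_lepoll eqpoll_sym)
    also have "\<dots> \<lesssim> {..<\<delta>}"
      using \<delta>(2) by (intro subset_imp_lepoll) (simp add: j1_def)
    finally show "A \<lesssim> {..<\<delta>}" .
    show "(\<lambda>\<beta>. f \<beta> \<delta>) ` A \<subseteq> {..<card_succ \<delta>}"
      using A_sub \<alpha>(1) prod \<delta>(1) by fastforce
  qed
  then obtain g where g: "\<And>\<delta>. \<delta> \<in> S' \<Longrightarrow> j1 \<le> \<delta> \<Longrightarrow> g \<delta> < card_succ \<delta> \<and> limit_ordinal (g \<delta>)"
      "\<And>\<delta> a. \<delta> \<in> S' \<Longrightarrow> j1 \<le> \<delta> \<Longrightarrow> a \<in> A \<Longrightarrow> f a \<delta> < g \<delta>"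
      "\<And>\<delta> \<eta>. \<delta> \<in> S' \<Longrightarrow> j1 \<le> \<delta> \<Longrightarrow> \<eta> < g \<delta> \<Longrightarrow> \<exists>a\<in>A. \<eta> < f a \<delta>"
    by metis
  have "\<exists>E. E \<in> \<C> \<delta> (g \<delta>)" if "\<delta> \<in> S'" "j1 \<le> \<delta>" for \<delta>
    using weak_square_seqD(4)[of \<delta> "\<C> \<delta>" "g \<delta>"] sq g(1) that by blast
  then obtain E where E: "\<And>\<delta>. \<delta> \<in> S' \<Longrightarrow> j1 \<le> \<delta> \<Longrightarrow> E \<delta> \<in> \<C> \<delta> (g \<delta>)"
    by metis
  have E_club: "club (g \<delta>) (E \<delta>)" and E_otp: "order_type (E \<delta>) \<le> \<delta>" if "\<delta> \<in> S'" "j1 \<le> \<delta>" for \<delta>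
    using weak_square_seqD(1,2)[of \<delta> "\<C> \<delta>" "g \<delta>"] sq g(1) E that by blast+
  \<comment> \<open>Some \<open>a\<close> in \<open>A\<close> lies above \<beta>, and
    \<open>f \<beta>\<close> is eventually below \<open>f a\<close>, which stays below
    \<open>g\<close>.\<close>
  have below: "\<exists>j<\<kappa>. j1 \<le> j \<and> (\<forall>\<delta>\<in>S'. j \<le> \<delta> \<longrightarrow> f \<beta> \<delta> < g \<delta>)" if \<beta>: "\<beta> < \<alpha>" for \<beta>
  proof -
    obtain a where a: "a \<in> A" "\<beta> < a"
      using A_greater[OF \<beta>] by blast
    have "a < card_succ \<kappa>"
      using a(1) A_sub \<alpha>(1) by auto
    then obtain j where j: "j < \<kappa>" "\<forall>\<delta>\<in>S'. j \<le> \<delta> \<longrightarrow> f \<beta> \<delta> < f a \<delta>"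
      using incr a(2) unfolding increasing_mod_bounded_def almost_all_def by blast
    have "f \<beta> \<delta> < g \<delta>" if "\<delta> \<in> S'" "max j j1 \<le> \<delta>" for \<delta>
      using j(2) g(2)[of \<delta> a] that a(1) by (auto intro: order.strict_trans)
    then show ?thesis
      using j(1) j1 by (intro exI[of _ "max j j1"]) auto
  qed
  \<comment> \<open>The first conjunct keeps closure points inside \<open>C0\<close>; the second
    makes them interleaved with \<open>E\<close>.\<close>
  define R where "R \<eta> \<zeta> \<longleftrightarrow> (\<exists>c\<in>C0. \<eta> < c \<and> c < \<zeta>) \<and>
    almost_all \<kappa> S' (\<lambda>\<delta>. \<exists>e\<in>E \<delta>. f \<eta> \<delta> \<le> e \<and> e < f \<zeta> \<delta>)" for \<eta> \<zeta>
  define C where "C = catch_up \<alpha> R"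
  have "club \<alpha> C"
    unfolding C_def
  proof (rule club_catch_up[OF cc_\<alpha>])
    fix \<xi> assume \<xi>: "\<xi> < \<alpha>"
    obtain \<xi>' where "\<xi>' < \<alpha>" "\<xi> < \<xi>'"
      using limit_ordinalD[OF \<alpha>(2) \<xi>] by blast
    then obtain c where c: "c \<in> C0" "\<xi> < c" "c < \<alpha>"
      using club_imp_unbounded[OF C0] by (meson less_le_trans)
    obtain j where j: "j < \<kappa>" "j1 \<le> j" "\<forall>\<delta>\<in>S'. j \<le> \<delta> \<longrightarrow> f \<xi> \<delta> < g \<delta>"
      using below[OF \<xi>] by blast
    have "\<exists>e a. e \<in> E \<delta> \<and> f \<xi> \<delta> \<le> e \<and> a \<in> A \<and> e < f a \<delta>" if \<delta>: "\<delta> \<in> S'" "j \<le> \<delta>" for \<delta>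
    proof -
      have "j1 \<le> \<delta>"
        using j(2) \<delta>(2) by simp
      moreover have "f \<xi> \<delta> < g \<delta>"
        using j(3) \<delta> by blast
      ultimately obtain e where "e \<in> E \<delta>" "f \<xi> \<delta> \<le> e" "e < g \<delta>"
        using club_imp_unbounded[OF E_club[OF \<delta>(1)]] by blast
      with g(3)[OF \<delta>(1) \<open>j1 \<le> \<delta>\<close>] show ?thesis by blast
    qed
    then obtain e a where ea: "\<And>\<delta>. \<delta> \<in> S' \<Longrightarrow> j \<le> \<delta> \<Longrightarrow>
        e \<delta> \<in> E \<delta> \<and> f \<xi> \<delta> \<le> e \<delta> \<and> a \<delta> \<in> A \<and> e \<delta> < f (a \<delta>) \<delta>"
      by metis
    \<comment> \<open>Each coordinate needs its own \<open>a \<delta>\<close> to pass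
      \<open>e \<delta>\<close>. There are at most \<open>cof \<kappa> < cof \<alpha>\<close> of
      them, so a single \<zeta> in \<open>A\<close> lies above all and serves every coordinate from
      \<open>j\<close> on.\<close>
    let ?X = "a ` {\<delta> \<in> S'. j \<le> \<delta>}"
    have "?X \<lesssim> {\<delta> \<in> S'. j \<le> \<delta>}"
      by (rule image_lepoll)
    also have "\<dots> \<lesssim> S'"
      by (rule subset_imp_lepoll) blast
    also note S'_card
    finally have X: "?X \<lesssim> {..<cof \<kappa>}" .
    have "?X \<subseteq> {..<\<alpha>}"
      using ea A_sub by blast
    then obtain b where b: "b < \<alpha>" "\<forall>x\<in>?X. x < b"
      using bounded_of_lepoll_cof[OF X \<alpha>(3)] by blast
    obtain \<zeta> where \<zeta>: "\<zeta> \<in> A" "max b c < \<zeta>"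
      using A_greater[of "max b c"] b(1) c(3) by auto
    have "f \<xi> \<delta> \<le> e \<delta> \<and> e \<delta> < f \<zeta> \<delta> \<and> e \<delta> \<in> E \<delta>" if \<delta>: "\<delta> \<in> S'" "j \<le> \<delta>" for \<delta>
    proof -
      have "a \<delta> < b"
        using b(2) \<delta> by blast
      then have "a \<delta> < \<zeta>"
        using \<zeta>(2) by (auto intro: order.strict_trans)
      moreover have "strict_mono_on A (\<lambda>\<beta>. f \<beta> \<delta>)"
        using mono[OF \<delta>(1)] \<delta>(2) j(2) by simp
      ultimately have "f (a \<delta>) \<delta> < f \<zeta> \<delta>"
        using ea[OF \<delta>] \<zeta>(1) by (auto dest: strict_mono_onD)
      with ea[OF \<delta>] show ?thesis by auto
    qed
    then have "almost_all \<kappa> S' (\<lambda>\<delta>. \<exists>e\<in>E \<delta>. f \<xi> \<delta> \<le> e \<and> e < f \<zeta> \<delta>)"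
      unfolding almost_all_def using j(1) by blast
    moreover have "\<zeta> < \<alpha>" "c < \<zeta>" "\<xi> < \<zeta>"
      using \<zeta> A_sub c(2) by auto
    ultimately show "\<exists>\<zeta><\<alpha>. \<xi> < \<zeta> \<and> R \<xi> \<zeta>"
      unfolding R_def using c(1,2) by blast
  next
    fix \<xi> \<eta> \<zeta> assume *: "\<eta> \<le> \<xi>" "\<xi> < \<zeta>" "\<zeta> < \<alpha>" "R \<xi> \<zeta>"
    show "R \<eta> \<zeta>"
    proof (cases "\<eta> = \<xi>")
      case False
      then have "\<eta> < \<xi>" "\<xi> < card_succ \<kappa>"
        using * \<alpha>(1) by auto
      then have "almost_all \<kappa> S' (\<lambda>\<delta>. f \<eta> \<delta> < f \<xi> \<delta>)"
        using incr unfolding increasing_mod_bounded_def by blast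
      moreover have "almost_all \<kappa> S' (\<lambda>\<delta>. \<exists>e\<in>E \<delta>. f \<xi> \<delta> \<le> e \<and> e < f \<zeta> \<delta>)"
        using *(4) by (simp add: R_def)
      ultimately have "almost_all \<kappa> S' (\<lambda>\<delta>. \<exists>e\<in>E \<delta>. f \<eta> \<delta> \<le> e \<and> e < f \<zeta> \<delta>)"
        by (rule almost_all_mono2) (auto intro: less_imp_le less_le_trans)
      moreover have "\<exists>c\<in>C0. \<eta> < c \<and> c < \<zeta>"
        using *(4) \<open>\<eta> < \<xi>\<close> unfolding R_def by (meson order.strict_trans)
      ultimately show ?thesis
        by (simp add: R_def)
    qed (use * in simp)
  qed
  moreover have "C \<subseteq> C0"
    unfolding C_def by (rule club_catch_up_subset[OF C0]) (auto simp: R_def)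
  moreover have C_int: "C \<subseteq> interleaved \<kappa> S' f E"
    unfolding C_def interleaved_def using catch_upD(3)[of _ \<alpha> R] by (fastforce simp: R_def)
  have "\<exists>Z\<in>coded_traces \<kappa> S' f (k \<beta>) \<beta>. C \<inter> {..<\<beta>} \<subseteq> Z" if \<beta>: "\<beta> < \<alpha>" for \<beta>
  proof -
    have \<beta>': "\<beta> < card_succ \<kappa>"
      using \<beta> \<alpha>(1) by simp
    define D where "D \<delta> = E \<delta> \<inter> {..<f \<beta> \<delta>}" for \<delta>
    obtain j where j: "j < \<kappa>" "j1 \<le> j" "\<forall>\<delta>\<in>S'. j \<le> \<delta> \<longrightarrow> f \<beta> \<delta> < g \<delta>"
      using below[OF \<beta>] by blast
    \<comment> \<open>The trace is one of at most \<delta> many, which gives its index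
      \<open>q\<close>. It lies below an element of \<open>E \<delta>\<close>, whose order type is
      at most \<delta>, so its size is bounded by some \<sigma> < \<delta>.\<close>
    have ex: "\<exists>q \<sigma>. q < \<delta> \<and> D \<delta> = k \<beta> \<delta> q \<and> \<sigma> < \<delta> \<and> D \<delta> \<lesssim> {..<\<sigma>}" if \<delta>: "\<delta> \<in> S'" "j \<le> \<delta>" for \<delta>
    proof -
      have j1\<delta>: "j1 \<le> \<delta>"
        using j(2) \<delta>(2) by simp
      have "D \<delta> \<in> seq_traces \<delta> (\<C> \<delta>) (f \<beta> \<delta>)"
        unfolding seq_traces_def D_def using g(1)[OF \<delta>(1) j1\<delta>] E[OF \<delta>(1) j1\<delta>] by blast
      then obtain q where "q < \<delta>" "D \<delta> = k \<beta> \<delta> q"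
        using k[OF \<beta>' \<delta>(1) inf[OF j1\<delta>]] by blast
      moreover obtain e where e: "e \<in> E \<delta>" "f \<beta> \<delta> \<le> e"
        using club_imp_unbounded[OF E_club[OF \<delta>(1) j1\<delta>]] j(3) \<delta> by blast
      have "E \<delta> \<subseteq> {..<g \<delta>}"
        using E_club[OF \<delta>(1) j1\<delta>] by (simp add: club_def unbounded_in_def)
      then have "D \<delta> \<prec> {..<\<delta>}"
        unfolding D_def using initial_segment_lesspoll[OF _ _ E_otp[OF \<delta>(1) j1\<delta>] e] sq[OF \<delta>(1)] by blast
      then obtain \<sigma> where "\<sigma> < \<delta>" "D \<delta> \<lesssim> {..<\<sigma>}"
        using lesspoll_initial_segment by blast
      ultimately show ?thesis by blast
    qed
    obtain q \<sigma> where q: "\<And>\<delta>. \<delta> \<in> S' \<Longrightarrow> j \<le> \<delta> \<Longrightarrow> q \<delta> < \<delta> \<and> D \<delta> = k \<beta> \<delta> (q \<delta>)"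
      and \<sigma>: "\<And>\<delta>. \<delta> \<in> S' \<Longrightarrow> j \<le> \<delta> \<Longrightarrow> \<sigma> \<delta> < \<delta> \<and> D \<delta> \<lesssim> {..<\<sigma> \<delta>}"
      using ex by metis
    \<comment> \<open>Index and size bound are pressed down together, so that one \<rho> and one
      cofinal \<open>T\<close> serve both.\<close>
    define i where "i \<delta> = max (q \<delta>) (\<sigma> \<delta>)" for \<delta>
    have "i \<delta> < \<delta>" if "\<delta> \<in> S \<inter> H" "j \<le> \<delta>" for \<delta>
      using q \<sigma> that by (simp add: i_def S')
    then obtain \<rho> where \<rho>: "\<rho> < \<kappa>" "\<forall>\<gamma><\<kappa>. \<exists>\<delta>\<in>S'. \<gamma> \<le> \<delta> \<and> j \<le> \<delta> \<and> i \<delta> \<le> \<rho>"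
      using pressing_down[OF cc_\<kappa> S H j(1), of i] unfolding S' by blast
    define T where "T = {\<delta> \<in> S'. j \<le> \<delta> \<and> i \<delta> \<le> \<rho>}"
    have T: "T \<subseteq> S'" "cofinal_subset \<kappa> T"
      using \<rho>(2) unfolding T_def cofinal_subset_def by blast+
    have TD: "D \<delta> = k \<beta> \<delta> (q \<delta>) \<and> q \<delta> \<le> \<rho> \<and> D \<delta> \<lesssim> {..<\<rho>}" if \<delta>: "\<delta> \<in> T" for \<delta>
    proof -
      have "q \<delta> \<le> \<rho>" "\<sigma> \<delta> \<le> \<rho>" "\<delta> \<in> S'" "j \<le> \<delta>"
        using \<delta> by (auto simp: T_def i_def)
      moreover have "{..<\<sigma> \<delta>} \<lesssim> {..<\<rho>}"
        using \<open>\<sigma> \<delta> \<le> \<rho>\<close> by (intro subset_imp_lepoll) auto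
      ultimately show ?thesis
        using q[of \<delta>] \<sigma>[of \<delta>] lepoll_trans by blast
    qed
    let ?Z = "interleaved \<kappa> T f (\<lambda>\<delta>. k \<beta> \<delta> (q \<delta>)) \<inter> {..<\<beta>}"
    have "\<forall>\<delta>\<in>T. q \<delta> \<le> \<rho> \<and> k \<beta> \<delta> (q \<delta>) \<lesssim> {..<\<rho>}"
      using TD by metis
    then have "?Z \<in> coded_traces \<kappa> S' f (k \<beta>) \<beta>"
      unfolding coded_traces_def using T \<rho>(1) by blast
    moreover have "interleaved \<kappa> S' f E \<inter> {..<\<beta>} \<subseteq> interleaved \<kappa> T f (\<lambda>\<delta>. k \<beta> \<delta> (q \<delta>))"
      by (rule interleaved_restrict[OF incr T(1) \<beta>']) (use TD D_def in metis)
    then have "C \<inter> {..<\<beta>} \<subseteq> ?Z"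
      using C_int by blast
    ultimately show ?thesis by blast
  qed
  ultimately show ?thesis by blast
qed

section \<open>Assembly of the clubs and their covering families\<close>

lemma less_star_imp_almost_all:
  assumes "less_star S f g" "S \<subseteq> {..<\<kappa>}" "T \<subseteq> S"
  shows "almost_all \<kappa> T (\<lambda>\<delta>. f \<delta> < g \<delta>)"
  using assms unfolding less_star_def almost_all_def by blast

text \<open>Fewer than \<open>cof \<kappa>\<close> many values of \<open>e\<close> are bounded below
  \<kappa>.\<close>

lemma small_sets_covered:
  fixes \<kappa> :: "'a::wellorder"
  assumes e: "inj_on e {..<\<beta>}" "e ` {..<\<beta>} \<subseteq> {..<\<kappa>}" and "X \<lesssim> {..<i}" "i < cof \<kappa>"
  shows "\<exists>\<rho><\<kappa>. X \<inter> {..<\<beta>} \<subseteq> {x \<in> {..<\<beta>}. e x < \<rho>}"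
proof -
  have "e ` (X \<inter> {..<\<beta>}) \<lesssim> X \<inter> {..<\<beta>}"
    by (rule image_lepoll)
  also have "\<dots> \<lesssim> X"
    by (rule subset_imp_lepoll) blast
  also note assms(3)
  finally have "e ` (X \<inter> {..<\<beta>}) \<lesssim> {..<i}" .
  moreover have "e ` (X \<inter> {..<\<beta>}) \<subseteq> {..<\<kappa>}"
    using e(2) by blast
  ultimately obtain \<rho> where "\<rho> < \<kappa>" "\<forall>x\<in>e ` (X \<inter> {..<\<beta>}). x < \<rho>"
    using bounded_of_lepoll_cof[OF _ assms(4)] by blast
  then show ?thesis by blast
qed

lemma club_greaterThan:
  assumes "club \<alpha> C" "\<gamma> < \<alpha>" "limit_ordinal \<alpha>"
  shows "club \<alpha> (C \<inter> {\<gamma><..})"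
proof -
  have "\<exists>c\<in>C \<inter> {\<gamma><..}. \<beta> \<le> c" if \<beta>: "\<beta> < \<alpha>" for \<beta>
  proof -
    have "max \<beta> \<gamma> < \<alpha>"
      using \<beta> assms(2) by simp
    then obtain \<beta>' where "\<beta>' < \<alpha>" "max \<beta> \<gamma> < \<beta>'"
      using limit_ordinalD[OF assms(3)] by blast
    moreover then obtain c where "c \<in> C" "\<beta>' \<le> c"
      using club_imp_unbounded[OF assms(1)] by blast
    ultimately show ?thesis
      by (intro bexI[of _ c]) auto
  qed
  moreover have "\<beta> \<in> C \<inter> {\<gamma><..}" if \<beta>: "\<beta> < \<alpha>" "limit_point (C \<inter> {\<gamma><..}) \<beta>" for \<beta>
  proof -
    have "limit_point C \<beta>"
      using \<beta>(2) unfolding limit_point_def by blast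
    then have "\<beta> \<in> C"
      using assms(1) \<beta>(1) by (simp add: club_def)
    moreover obtain c where "c \<in> C \<inter> {\<gamma><..}" "c < \<beta>"
      using \<beta>(2) unfolding limit_point_def by blast
    ultimately show ?thesis by auto
  qed
  ultimately show ?thesis
    using assms(1) unfolding club_def unbounded_in_def by blast
qed

theorem theorem1p1:
  fixes \<kappa> lam :: "'a::wellorder" and S :: "'a set"
  assumes succ_exists: "\<exists>\<nu>::'a. {..<\<kappa>} \<prec> {..<\<nu>}"
    and "singular_cardinal \<kappa>" and "strong_limit_cardinal \<kappa>"
    and "cof \<kappa> = lam" and "omega < lam"
    and "stationary \<kappa> S"
    and "\<forall>\<delta>\<in>S. is_cardinal \<delta> \<and> weak_square \<delta>"
    and "\<exists>f. good_scale \<kappa> S f"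
  shows "weak_square \<kappa>"
proof -
  note S = \<open>stationary \<kappa> S\<close> and strong = \<open>strong_limit_cardinal \<kappa>\<close>
  have card: "is_cardinal \<kappa>" and inf: "infinite {..<\<kappa>}" and sing: "cof \<kappa> < \<kappa>"
    using assms(2) by (simp_all add: singular_cardinal_def)
  have unctbl: "omega < cof \<kappa>"
    using assms(4,5) by simp
  have lim: "limit_ordinal \<kappa>"
    using card inf by (rule infinite_cardinal_limit)
  \<comment> \<open>Here the existence of a larger ordinal in the type ensures that
    \<open>card_succ \<kappa>\<close> is the true successor cardinal.\<close>
  have succ: "{..<\<kappa>} \<prec> {..<card_succ \<kappa>}"
    using succ_exists lesspoll_card_succ by blast
  have S_sub: "S \<subseteq> {..<\<kappa>}"
    using S by (simp add: stationary_def)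

  \<comment> \<open>Thinning \<open>S\<close> to a club of size at most \<open>cof \<kappa>\<close>
    keeps pressing down available, makes the number of codes small, and lets
    \<open>cof \<kappa> < cof \<alpha>\<close> bound choices over all coordinates at once.\<close>
  obtain s where s: "club \<kappa> (s ` {..<cof \<kappa>})"
    using ex_cofinal_club[OF lim] by blast
  define H where "H = s ` {..<cof \<kappa>}"
  define S' where "S' = S \<inter> H"
  have S'_card: "S' \<lesssim> {..<cof \<kappa>}"
    unfolding S'_def H_def by (rule subset_image_lepoll) blast
  also have "{..<cof \<kappa>} \<prec> {..<\<kappa>}"
    using card sing by (simp add: is_cardinal_def)
  finally have S'_small: "S' \<prec> {..<\<kappa>}" .

  obtain \<C> where sq: "\<And>\<delta>. \<delta> \<in> S \<Longrightarrow> is_cardinal \<delta> \<and> weak_square_seq \<delta> (\<C> \<delta>)"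
    using assms(7) unfolding weak_square_def by metis
  obtain f D where scale: "scale \<kappa> S f" and D: "club (card_succ \<kappa>) D"
    and good: "\<And>\<alpha>. \<alpha> \<in> D \<Longrightarrow> cof \<kappa> < cof \<alpha> \<Longrightarrow> good_point S f \<alpha>"
    using assms(8) unfolding good_scale_def by blast
  have prod: "f \<beta> \<delta> < card_succ \<delta>" if "\<beta> < card_succ \<kappa>" "\<delta> \<in> S'" for \<beta> \<delta>
    using scale that unfolding scale_def succ_product_def S'_def by fastforce
  have incr: "increasing_mod_bounded \<kappa> S' f"
    unfolding increasing_mod_bounded_def
  proof (intro allI impI)
    fix \<alpha> \<beta> assume "\<alpha> < card_succ \<kappa>" "\<beta> < \<alpha>"
    then have "less_star S (f \<beta>) (f \<alpha>)"
      using scale by (simp add: scale_def)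
    then show "almost_all \<kappa> S' (\<lambda>\<delta>. f \<beta> \<delta> < f \<alpha> \<delta>)"
      using S_sub by (rule less_star_imp_almost_all) (simp add: S'_def)
  qed
  have "\<exists>k. infinite {..<\<delta>} \<longrightarrow> seq_traces \<delta> (\<C> \<delta>) (f \<beta> \<delta>) \<subseteq> k ` {..<\<delta>}"
    if "\<beta> < card_succ \<kappa>" "\<delta> \<in> S'" for \<beta> \<delta>
    using seq_traces_lepoll[of \<delta> "\<C> \<delta>" "f \<beta> \<delta>"] sq[of \<delta>] prod[OF that] that(2)
    unfolding lepoll_iff S'_def by blast
  then obtain k where k: "\<And>\<beta> \<delta>. \<beta> < card_succ \<kappa> \<Longrightarrow> \<delta> \<in> S' \<Longrightarrow> infinite {..<\<delta>} \<Longrightarrow>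
      seq_traces \<delta> (\<C> \<delta>) (f \<beta> \<delta>) \<subseteq> k \<beta> \<delta> ` {..<\<delta>}"
    by metis
  have "\<exists>e. inj_on e {..<\<beta>} \<and> e ` {..<\<beta>} \<subseteq> {..<\<kappa>}" if "\<beta> < card_succ \<kappa>" for \<beta>
    using card_succ_lepoll[OF that] unfolding lepoll_def .
  then obtain e where e: "\<And>\<beta>. \<beta> < card_succ \<kappa> \<Longrightarrow> inj_on (e \<beta>) {..<\<beta>}"
      "\<And>\<beta>. \<beta> < card_succ \<kappa> \<Longrightarrow> e \<beta> ` {..<\<beta>} \<subseteq> {..<\<kappa>}"
    by metis

  \<comment> \<open>The first family covers initial segments at ordinals of cofinality at most
    \<open>cof \<kappa>\<close>, the second those at good points.\<close>
  define F where "F \<beta> = (\<lambda>\<rho>. {x \<in> {..<\<beta>}. e \<beta> x < \<rho>}) ` {..<\<kappa>} \<union> coded_traces \<kappa> S' f (k \<beta>) \<beta>" for \<beta>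
  \<comment> \<open>The first alternative exempts those \<beta> for which \<alpha> lies before the
    next point of \<open>D\<close> above \<beta>.\<close>
  have "\<exists>C. club \<alpha> C \<and> C \<prec> {..<\<kappa>} \<and> (\<forall>\<beta><\<alpha>. limit_point C \<beta> \<longrightarrow>
      D \<inter> {\<beta><..\<alpha>} = {} \<or> (\<exists>Z\<in>F \<beta>. C \<inter> {..<\<beta>} \<subseteq> Z))"
    if \<alpha>: "\<alpha> < card_succ \<kappa>" "limit_ordinal \<alpha>" for \<alpha>
  proof -
    have cof_\<alpha>: "cof \<alpha> < \<kappa>"
      using lim sing card_succ_lepoll[OF \<alpha>(1)] by (rule cof_less_singular)
    obtain t where t: "strict_mono_on {..<cof \<alpha>} t" "club \<alpha> (t ` {..<cof \<alpha>})"
      using ex_cofinal_club[OF \<alpha>(2)] by blast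
    define C0 where "C0 = t ` {..<cof \<alpha>}"
    have C0: "club \<alpha> C0"
      using t(2) by (simp add: C0_def)
    have "C0 \<lesssim> {..<cof \<alpha>}"
      unfolding C0_def by (rule image_lepoll)
    also have "\<dots> \<prec> {..<\<kappa>}"
      using card cof_\<alpha> by (simp add: is_cardinal_def)
    finally have C0_small: "C0 \<prec> {..<\<kappa>}" .
    show ?thesis
    proof (cases "\<alpha> \<in> D")
      case False
      then have "\<not> limit_point D \<alpha>"
        using D \<alpha>(1) by (auto simp: club_def)
      \<comment> \<open>Since \<alpha> is neither in \<open>D\<close> nor a limit of it,
        \<open>D\<close> misses the interval from \<gamma> to \<alpha>. Every limit point of the
        tail of \<open>C0\<close> above \<gamma> is then exempt.\<close>
      then obtain \<gamma> where \<gamma>: "\<gamma> < \<alpha>" "\<forall>\<xi>\<in>D. \<gamma> < \<xi> \<longrightarrow> \<not> \<xi> < \<alpha>"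
        using \<alpha>(2) unfolding limit_point_def limit_ordinal_def by blast
      have "D \<inter> {\<beta><..\<alpha>} = {}" if \<beta>: "limit_point (C0 \<inter> {\<gamma><..}) \<beta>" for \<beta>
      proof -
        obtain c where "\<gamma> < c" "c < \<beta>"
          using \<beta> unfolding limit_point_def by blast
        then have "\<gamma> < \<xi>" if "\<beta> < \<xi>" for \<xi>
          using that by simp
        then show ?thesis
          using \<gamma>(2) False by (force simp: le_less)
      qed
      moreover have "C0 \<inter> {\<gamma><..} \<prec> {..<\<kappa>}"
        using C0_small by (rule lesspoll_trans1[rotated]) (simp add: subset_imp_lepoll)
      ultimately show ?thesis
        using club_greaterThan[OF C0 \<gamma>(1) \<alpha>(2)] by blast
    next
      case True
      show ?thesis
      proof (cases "cof \<kappa> < cof \<alpha>")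
        case False
        have "\<exists>Z\<in>F \<beta>. C0 \<inter> {..<\<beta>} \<subseteq> Z" if \<beta>: "\<beta> < \<alpha>" for \<beta>
        proof -
          have \<beta>': "\<beta> < card_succ \<kappa>"
            using \<beta> \<alpha>(1) by simp
          obtain i where i: "i < cof \<alpha>" "C0 \<inter> {..<\<beta>} \<lesssim> {..<i}"
            using cofinal_club_initial_lepoll[OF t \<beta>] unfolding C0_def by blast
          have "i < cof \<kappa>"
            using i(1) False by (meson less_le_trans not_le)
          then obtain \<rho> where "\<rho> < \<kappa>" "C0 \<inter> {..<\<beta>} \<inter> {..<\<beta>} \<subseteq> {x \<in> {..<\<beta>}. e \<beta> x < \<rho>}"
            using small_sets_covered[OF e[OF \<beta>'] i(2)] by blast
          then show ?thesis
            unfolding F_def by blast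
        qed
        then show ?thesis
          using C0 C0_small by blast
      next
        case cof_less: True
        have unctbl_\<alpha>: "omega < cof \<alpha>"
          using unctbl cof_less by simp
        have "infinite {..<omega::'a}"
          using inf by (rule infinite_omega)
        then have inf_cof: "infinite {..<cof \<alpha>}"
          using unctbl_\<alpha> by (meson finite_subset less_imp_le lessThan_subset_iff)
        then have "infinite {..<\<alpha>}"
          using cof_le_self[of \<alpha>] by (meson finite_subset lessThan_subset_iff)
        then have cc_\<alpha>: "uncountable_cof \<alpha>"
          using unctbl_\<alpha> by (rule uncountable_cofI)
        obtain A j where A: "unbounded_in \<alpha> A" "order_type A = cof \<alpha>"
          and j: "j \<in> S" "\<forall>\<delta>\<in>S. j \<le> \<delta> \<longrightarrow> strict_mono_on A (\<lambda>\<beta>. f \<beta> \<delta>)"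
          using good[OF True cof_less] unfolding good_point_def by blast
        have "almost_all \<kappa> S' (\<lambda>\<delta>. strict_mono_on A (\<lambda>\<beta>. f \<beta> \<delta>))"
          unfolding almost_all_def using j S_sub by (intro exI[of _ j]) (auto simp: S'_def)
        then obtain C where C: "C \<subseteq> C0" "club \<alpha> C"
            "\<forall>\<beta><\<alpha>. \<exists>Z\<in>coded_traces \<kappa> S' f (k \<beta>) \<beta>. C \<inter> {..<\<beta>} \<subseteq> Z"
          using good_point_club[OF card uncountable_cofI[OF inf unctbl] S s[folded H_def] S'_def
              S'_card prod incr _ k \<alpha> cof_less cof_\<alpha> cc_\<alpha> inf_cof C0 A] sq S'_def by blast
        have "C \<prec> {..<\<kappa>}"
          using subset_imp_lepoll[OF C(1)] C0_small by (rule lesspoll_trans1)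
        moreover have "\<exists>Z\<in>F \<beta>. C \<inter> {..<\<beta>} \<subseteq> Z" if "\<beta> < \<alpha>" for \<beta>
          using C(3)[rule_format, OF that] unfolding F_def by (rule bexE) (rule bexI, assumption, rule UnI2)
        ultimately show ?thesis
          using C(2) by blast
      qed
    qed
  qed
  then obtain C where C: "\<And>\<alpha>. \<alpha> < card_succ \<kappa> \<Longrightarrow> limit_ordinal \<alpha> \<Longrightarrow> club \<alpha> (C \<alpha>)"
      "\<And>\<alpha>. \<alpha> < card_succ \<kappa> \<Longrightarrow> limit_ordinal \<alpha> \<Longrightarrow> C \<alpha> \<prec> {..<\<kappa>}"
      "\<And>\<alpha> \<beta>. \<alpha> < card_succ \<kappa> \<Longrightarrow> limit_ordinal \<alpha> \<Longrightarrow> \<beta> < \<alpha> \<Longrightarrow> limit_point (C \<alpha>) \<beta> \<Longrightarrow>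
        D \<inter> {\<beta><..\<alpha>} = {} \<or> (\<exists>Z\<in>F \<beta>. C \<alpha> \<inter> {..<\<beta>} \<subseteq> Z)"
    by metis
  \<comment> \<open>For these \<alpha> the trace of \<open>C \<alpha>\<close> is itself added to the
    covering family. The case \<alpha> = \<beta> always qualifies, which settles coverage of the
    whole club.\<close>
  define N where "N \<beta> = {\<alpha>. \<alpha> < card_succ \<kappa> \<and> limit_ordinal \<alpha> \<and> \<beta> \<le> \<alpha> \<and> D \<inter> {\<beta><..\<alpha>} = {}}" for \<beta>
  define G where "G \<beta> = (\<lambda>\<alpha>. C \<alpha> \<inter> {..<\<beta>}) ` N \<beta> \<union> F \<beta>" for \<beta>
  show ?thesis
  proof (rule weak_square_of_covering[OF strong _ _ C(1,2)])
    fix \<beta> assume \<beta>: "\<beta> < card_succ \<kappa>"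
    obtain \<gamma> where "\<gamma> < card_succ \<kappa>" "\<beta> < \<gamma>"
      using card_succ_greater[OF inf succ \<beta>] by blast
    \<comment> \<open>A point of \<open>D\<close> above \<beta> bounds \<open>N \<beta>\<close>, so
      only \<kappa> many traces are added.\<close>
    then obtain d where d: "d \<in> D" "\<beta> < d" "d < card_succ \<kappa>"
      using club_imp_unbounded[OF D] by (meson less_le_trans)
    have "N \<beta> \<subseteq> {..<d}"
      using d(1,2) unfolding N_def by force
    then have "N \<beta> \<lesssim> {..<\<kappa>}"
      using card_succ_lepoll[OF d(3)] subset_imp_lepoll lepoll_trans by blast
    then have "(\<lambda>\<alpha>. C \<alpha> \<inter> {..<\<beta>}) ` N \<beta> \<lesssim> {..<\<kappa>}"
      using image_lepoll lepoll_trans by blast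
    then show "G \<beta> \<lesssim> {..<\<kappa>}"
      unfolding G_def F_def
      by (intro Un_lepoll_infinite[OF inf] coded_traces_lepoll[OF strong S'_small] image_lepoll)
    fix Z assume "Z \<in> G \<beta>"
    then consider \<alpha> where "\<alpha> \<in> N \<beta>" "Z = C \<alpha> \<inter> {..<\<beta>}"
      | \<rho> where "\<rho> < \<kappa>" "Z = {x \<in> {..<\<beta>}. e \<beta> x < \<rho>}" | "Z \<in> coded_traces \<kappa> S' f (k \<beta>) \<beta>"
      unfolding G_def F_def by blast
    then show "Z \<prec> {..<\<kappa>}"
    proof cases
      case 1
      then have "Z \<lesssim> C \<alpha>" "C \<alpha> \<prec> {..<\<kappa>}"
        using C(2) by (auto simp: N_def intro: subset_imp_lepoll)
      then show ?thesis
        by (rule lesspoll_trans1)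
    next
      case 2
      have "inj_on (e \<beta>) Z" "e \<beta> ` Z \<subseteq> {..<\<rho>}"
        using e(1)[OF \<beta>] 2(2) by (auto intro: inj_on_subset)
      then have "Z \<lesssim> {..<\<rho>}"
        unfolding lepoll_def by blast
      moreover have "{..<\<rho>} \<prec> {..<\<kappa>}"
        using card 2(1) by (simp add: is_cardinal_def)
      ultimately show ?thesis
        by (rule lesspoll_trans1)
    next
      case 3
      then show ?thesis
        by (rule coded_traces_lesspoll[OF strong S'_small incr \<beta>])
    qed
  next
    fix \<alpha> \<beta> assume *: "\<alpha> < card_succ \<kappa>" "limit_ordinal \<alpha>" "\<beta> \<le> \<alpha>" "limit_point (C \<alpha>) \<beta>"
    show "\<exists>Z\<in>G \<beta>. C \<alpha> \<inter> {..<\<beta>} \<subseteq> Z"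
    proof (cases "D \<inter> {\<beta><..\<alpha>} = {}")
      case True
      then have "\<alpha> \<in> N \<beta>"
        using * by (simp add: N_def)
      then show ?thesis
        unfolding G_def by blast
    next
      case False
      then have "\<beta> < \<alpha>"
        by auto
      then show ?thesis
        using C(3)[OF *(1,2) _ *(4)] False unfolding G_def by blast
    qed
  qed
qed

end
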